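(* Let $n\ge 1$ and let $X=(X_1,\ldots,X_n)$ be a centered Gaussian vector with $\mathbb{E} X_i^2=\sigma_i^2$, $\sigma_i>0$, for each $1\le i\le n$, and with positive definite covariance matrix $C$. Assume that $p\ge 2$ is a real number such that $p\ge 2\,p(X)$, where $p(X)$ is the decoupling coefficient of $X$. Then for any $\varepsilon_i>0$, $i=1,\ldots,n$, $$\prod_{i=1}^n\mathbb{P}\big\{|X_i|\le\varepsilon_i\big\}\ \le\ \mathbb{P}\Big\{\sup_{1\le i\le n}\frac{|X_i|}{\varepsilon_i}\le 1\Big\}\ \le\ \frac{2^{\frac n2}}{\det(C)^{\frac1{2p}}}\ \prod_{i=1}^n\Big(\frac{\sigma_i}{\sqrt2}\ \mathbb{P}\big\{|X_i|\le\varepsilon_i\big\}\Big)^{\frac1p}.$$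
   Context: For a centered Gaussian vector $X=(X_1,\ldots,X_n)$ with non-degenerate components (i.e. $\mathbb{E}X_i^2>0$ for all $i$), the decoupling coefficient of $X$ is $$p(X)=\max_{1\le i\le n}\ \sum_{1\le j\le n}\frac{|\mathbb{E}X_iX_j|}{\mathbb{E}X_i^2}$$ (the term $j=i$, equal to $1$, is included in the sum). The covariance matrix of $X$ is $C=\{\mathbb{E}X_iX_j\}_{i,j=1}^n$. *)

theory Defs
  imports "HOL-Analysis.Analysis" "HOL-Probability.Probability"
begin

text \<open>
  The one-dimensional normal law with mean \<open>\<mu>\<close> and standard deviation \<open>\<sigma>\<close>.
  The degenerate case \<open>\<sigma> = 0\<close> is the point mass at \<open>\<mu>\<close>; it is needed because a
  linear form of a Gaussian vector may be almost surely constant.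
\<close>

definition gaussian_law :: "real \<Rightarrow> real \<Rightarrow> real measure" where
  "gaussian_law \<mu> \<sigma> =
     (if \<sigma> = 0 then return borel \<mu> else density lborel (\<lambda>x. ennreal (normal_density \<mu> \<sigma> x)))"

definition gaussian_vector :: "'a measure \<Rightarrow> ('a \<Rightarrow> real ^ 'n) \<Rightarrow> bool" where
  "gaussian_vector M X \<longleftrightarrow>
     prob_space M \<and> X \<in> borel_measurable M \<and>
     (\<forall>a. \<exists>\<mu> \<sigma>. 0 \<le> \<sigma> \<and> distr M borel (\<lambda>\<omega>. a \<bullet> X \<omega>) = gaussian_law \<mu> \<sigma>)"

definition centered_gaussian_vector :: "'a measure \<Rightarrow> ('a \<Rightarrow> real ^ 'n) \<Rightarrow> bool" where
  "centered_gaussian_vector M X \<longleftrightarrow>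
     gaussian_vector M X \<and> (\<forall>i. (LINT \<omega>|M. X \<omega> $ i) = 0)"

text \<open>The matrix of second moments; it is the covariance matrix for centered \<open>X\<close>.\<close>

definition covariance_matrix :: "'a measure \<Rightarrow> ('a \<Rightarrow> real ^ 'n) \<Rightarrow> real ^ 'n ^ 'n" where
  "covariance_matrix M X = (\<chi> i j. LINT \<omega>|M. X \<omega> $ i * X \<omega> $ j)"

definition positive_definite :: "real ^ 'n ^ 'n \<Rightarrow> bool" where
  "positive_definite A \<longleftrightarrow> transpose A = A \<and> (\<forall>x. x \<noteq> 0 \<longrightarrow> 0 < x \<bullet> (A *v x))"

definition decoupling_coefficient :: "'a measure \<Rightarrow> ('a \<Rightarrow> real ^ 'n) \<Rightarrow> real" where
  "decoupling_coefficient M X =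
     (MAX i. \<Sum>j\<in>UNIV. \<bar>LINT \<omega>|M. X \<omega> $ i * X \<omega> $ j\<bar> / (LINT \<omega>|M. (X \<omega> $ i)\<^sup>2))"

end

theory Submission
  imports Defs
begin

text \<open>
  Write \<open>C\<close> for the covariance matrix. Gram-Schmidt for the inner product \<open>x \<bullet> C y\<close> gives a
  matrix \<open>V\<close> with \<open>V\<^sup>T C V = 1\<close>, so that \<open>Z = V\<^sup>T X\<close> is standard normal
  (\<open>gaussian_whitening\<close>) and \<open>X = L Z\<close> for \<open>L = C V\<close>, where \<open>L L\<^sup>T = C\<close>. The hypothesis only
  speaks of the laws of linear forms of \<open>X\<close>; that these determine the law of \<open>Z\<close> is reduced to
  the uniqueness theorem for characteristic functions on the line, one coordinate at a time.

  The lower bound is Sidak's inequality (\<open>sidak_inequality\<close>). One slab is split off at a time. One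
  column of \<open>V\<close> is chosen so that the slab becomes \<open>\<bar>z\<^sub>k\<bar> \<le> r\<close> in the coordinates of
  \<open>Z\<close>, while the other constraints become a symmetric convex set \<open>K\<close>. Averaging the indicator of
  \<open>K\<close> over all coordinates but \<open>z\<^sub>k\<close> leaves an even function of \<open>z\<^sub>k\<close> which is log-concave by the
  Prekopa-Leindler inequality, hence decreasing in \<open>\<bar>z\<^sub>k\<bar>\<close>. It is therefore positively correlated
  with the indicator of the slab. Each averaging integrates out one real variable, so the
  one-dimensional Prekopa-Leindler inequality suffices.

  The upper bound is Hoelder's inequality between the density of \<open>X\<close> and the density of
  independent variables with the same variances. With \<open>q\<close> the decoupling coefficient, Gershgorin's
  estimate gives \<open>C \<le> q diag(\<sigma>\<^sub>i\<^sup>2)\<close>. In the coordinates of \<open>Z\<close> this bounds the standard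
  normal density pointwise by a constant times \<open>u powr (1 / p) * w powr (1 - 1 / p)\<close>, where
  \<open>u\<close> is the density of the independent variables, pulled back along \<open>L\<close>, and \<open>w\<close> is the density
  of a centered Gaussian vector with covariance \<open>2\<close> times the identity; the exponents match as
  soon as \<open>q \<le> (p + 1) / 2\<close>, which follows from \<open>2 q \<le> p\<close> (\<open>gaussian_density_interpolation\<close>).
  Over the box \<open>u\<close> has integral \<open>\<Prod>\<^sub>i P(\<bar>X\<^sub>i\<bar> \<le> \<epsilon>\<^sub>i)\<close>, and \<open>w\<close> has total integral one. The variance
  \<open>2\<close> is what produces the powers of \<open>2\<close> in the bound, and \<open>(det L)\<^sup>2 = det C\<close> produces the
  power of the determinant.
\<close>

section \<open>The Prekopa-Leindler inequality on the line\<close>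

lemma emeasure_lborel_affine_image:
  fixes A :: "real set"
  assumes A: "A \<in> sets borel" and m: "m > 0"
  shows "(\<lambda>x. m * x + d) ` A \<in> sets borel"
    and "emeasure lborel ((\<lambda>x. m * x + d) ` A) = ennreal m * emeasure lborel A"
proof -
  have "(\<lambda>x. m * x + d) ` A = (\<lambda>y. (y - d) / m) -` A \<inter> space borel"
    using m by (auto simp: image_iff field_simps intro!: bexI[of _ "(_ - d) / m"])
  moreover have "(\<lambda>y. (y - d) / m) \<in> borel \<rightarrow>\<^sub>M borel"
    by measurable
  ultimately show B: "(\<lambda>x. m * x + d) ` A \<in> sets borel"
    using A by (metis measurable_sets)
  have "emeasure lebesgue ((\<lambda>x. m *\<^sub>R x + d) ` A) = ennreal (\<bar>m\<bar> ^ DIM(real)) * emeasure lebesgue A"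
    using emeasure_lebesgue_affine[of m d A] by simp
  then show "emeasure lborel ((\<lambda>x. m * x + d) ` A) = ennreal m * emeasure lborel A"
    using A B m by (simp add: emeasure_completion)
qed

text \<open>
  For a point \<open>a\<close> near the supremum of \<open>A\<close> and a point \<open>b\<close> near the infimum of \<open>B\<close>, the set \<open>C\<close>
  contains a scaled copy of \<open>A\<close> (pairing each point with \<open>b\<close>) and a scaled copy of \<open>B\<close> (pairing
  each point with \<open>a\<close>). The first copy lies essentially to the left of the second, so they overlap
  in an interval of length at most the tolerance.
\<close>
lemma brunn_minkowski_real_bounded:
  fixes A B C :: "real set"
  assumes meas: "A \<in> sets borel" "B \<in> sets borel" "C \<in> sets borel"
    and bdd: "bounded A" "bounded B" and ne: "A \<noteq> {}" "B \<noteq> {}"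
    and l: "0 < l" "l < 1"
    and C: "\<And>x y. x \<in> A \<Longrightarrow> y \<in> B \<Longrightarrow> (1 - l) * x + l * y \<in> C"
  shows "ennreal (1 - l) * emeasure lborel A + ennreal l * emeasure lborel B \<le> emeasure lborel C"
proof (rule ennreal_le_epsilon)
  fix e :: real assume e: "0 < e"
  have bA: "bdd_above A" and bB: "bdd_below B"
    using bdd by (auto simp: bounded_imp_bdd_above bounded_imp_bdd_below)
  obtain a where a: "a \<in> A" "Sup A - e < a"
    using less_cSupD[of A "Sup A - e"] ne e by auto
  obtain b where b: "b \<in> B" "b < Inf B + e"
    using cInf_lessD[of B "Inf B + e"] ne e by auto
  define A' where "A' = (\<lambda>x. (1 - l) * x + l * b) ` A"
  define B' where "B' = (\<lambda>y. l * y + (1 - l) * a) ` B"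
  have A': "A' \<in> sets borel" "emeasure lborel A' = ennreal (1 - l) * emeasure lborel A"
    unfolding A'_def using emeasure_lborel_affine_image[OF meas(1), of "1 - l" "l * b"] l by auto
  have B': "B' \<in> sets borel" "emeasure lborel B' = ennreal l * emeasure lborel B"
    unfolding B'_def using emeasure_lborel_affine_image[OF meas(2), of l "(1 - l) * a"] l by auto
  have sub: "A' \<union> B' \<subseteq> C"
    using C a b by (auto simp: A'_def B'_def add.commute)
  have "A' \<inter> B' \<subseteq> {(1 - l) * a + l * Inf B .. (1 - l) * Sup A + l * b}"
  proof
    fix x assume x: "x \<in> A' \<inter> B'"
    obtain u where u: "u \<in> A" "x = (1 - l) * u + l * b"
      using x by (auto simp: A'_def)
    obtain v where v: "v \<in> B" "x = l * v + (1 - l) * a"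
      using x by (auto simp: B'_def)
    have "(1 - l) * u \<le> (1 - l) * Sup A" "l * Inf B \<le> l * v"
      using l u v bA bB by (auto intro!: mult_left_mono cSup_upper cInf_lower)
    then show "x \<in> {(1 - l) * a + l * Inf B .. (1 - l) * Sup A + l * b}"
      using u v by auto
  qed
  then have "emeasure lborel (A' \<inter> B') \<le> emeasure lborel {(1 - l) * a + l * Inf B .. (1 - l) * Sup A + l * b}"
    by (intro emeasure_mono) auto
  also have "\<dots> \<le> ennreal e"
  proof (cases "(1 - l) * a + l * Inf B \<le> (1 - l) * Sup A + l * b")
    case True
    have "(1 - l) * (Sup A - a) \<le> (1 - l) * e" "l * (b - Inf B) \<le> l * e"
      using a b l by (auto intro!: mult_left_mono)
    then have "((1 - l) * Sup A + l * b) - ((1 - l) * a + l * Inf B) \<le> e"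
      by (simp add: algebra_simps)
    then show ?thesis using True by (simp add: ennreal_leI)
  qed auto
  finally have ov: "emeasure lborel (A' \<inter> B') \<le> ennreal e" .
  have "emeasure lborel A' + emeasure lborel B' = emeasure lborel (A' \<union> B') + emeasure lborel (A' \<inter> B')"
    using A' B' by (intro emeasure_Un_Int) auto
  also have "\<dots> \<le> emeasure lborel C + ennreal e"
    using sub meas ov by (intro add_mono emeasure_mono) auto
  finally show "ennreal (1 - l) * emeasure lborel A + ennreal l * emeasure lborel B
      \<le> emeasure lborel C + ennreal e"
    using A' B' by simp
qed

text \<open>Boundedness is removed by truncating both sets to \<open>{- n..n}\<close> and letting \<open>n\<close> grow.\<close>
lemma brunn_minkowski_real:
  fixes A B C :: "real set"
  assumes meas: "A \<in> sets borel" "B \<in> sets borel" "C \<in> sets borel"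
    and ne: "A \<noteq> {}" "B \<noteq> {}"
    and l: "0 < l" "l < 1"
    and C: "\<And>x y. x \<in> A \<Longrightarrow> y \<in> B \<Longrightarrow> (1 - l) * x + l * y \<in> C"
  shows "ennreal (1 - l) * emeasure lborel A + ennreal l * emeasure lborel B \<le> emeasure lborel C"
proof -
  define T where "T n D = D \<inter> {- real n .. real n}" for n D
  have lim: "(\<lambda>n. emeasure lborel (T n D)) \<longlonglongrightarrow> emeasure lborel D" if D: "D \<in> sets borel" for D
  proof -
    have "(\<Union>n. T n D) = D"
    proof -
      have "\<exists>n. - real n \<le> x \<and> x \<le> real n" for x
        using real_arch_simple[of "\<bar>x\<bar>"] by (metis abs_le_D1 abs_le_D2 minus_le_iff)
      then show ?thesis by (auto simp: T_def)
    qed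
    moreover have "incseq (\<lambda>n. T n D)"
      by (force simp: T_def incseq_def)
    ultimately show ?thesis
      using Lim_emeasure_incseq[of "\<lambda>n. T n D" lborel] D
      by (auto simp: T_def image_subset_iff)
  qed
  obtain a b where ab: "a \<in> A" "b \<in> B" using ne by auto
  obtain n0 where n0: "\<bar>a\<bar> \<le> real n0" "\<bar>b\<bar> \<le> real n0"
    using real_arch_simple[of "max \<bar>a\<bar> \<bar>b\<bar>"] by auto
  show ?thesis
  proof (rule LIMSEQ_le_const2)
    show "(\<lambda>n. ennreal (1 - l) * emeasure lborel (T n A) + ennreal l * emeasure lborel (T n B))
      \<longlonglongrightarrow> ennreal (1 - l) * emeasure lborel A + ennreal l * emeasure lborel B"
      by (intro tendsto_add ennreal_tendsto_cmult lim meas) auto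
    show "\<exists>N. \<forall>n\<ge>N. ennreal (1 - l) * emeasure lborel (T n A) + ennreal l * emeasure lborel (T n B)
      \<le> emeasure lborel C"
    proof (intro exI allI impI)
      fix n assume "n0 \<le> n"
      then have "a \<in> T n A" "b \<in> T n B"
        using ab n0 by (auto simp: T_def)
      then show "ennreal (1 - l) * emeasure lborel (T n A) + ennreal l * emeasure lborel (T n B)
          \<le> emeasure lborel C"
        using meas l C
        by (intro brunn_minkowski_real_bounded) 
           (auto simp: T_def bounded_Int)
    qed
  qed
qed

text \<open>
  The levels are cut off at one because the Brunn-Minkowski inequality applies to level sets only
  while these are nonempty; functions normalised to have supremum one lose nothing.
\<close>
lemma layer_cake_unit:
  fixes F :: "real \<Rightarrow> real"
  assumes [measurable]: "F \<in> borel_measurable borel" and F: "\<And>x. 0 \<le> F x"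
  shows "(\<integral>\<^sup>+x. ennreal (min 1 (F x)) \<partial>lborel)
    = (\<integral>\<^sup>+t. indicator {0<..<1} t * emeasure lborel {x. t < F x} \<partial>lborel)"
proof -
  have "ennreal (min 1 (F x)) = (\<integral>\<^sup>+t. indicator {0<..<1} t * indicator {x. t < F x} x \<partial>lborel)" for x
  proof -
    have "(\<integral>\<^sup>+t. indicator {0<..<1} t * indicator {x. t < F x} x \<partial>lborel)
      = (\<integral>\<^sup>+t. indicator {0<..<min 1 (F x)} t \<partial>lborel)"
      by (intro nn_integral_cong) (auto split: split_indicator)
    also have "\<dots> = emeasure lborel {0<..<min 1 (F x)}"
      by simp
    finally show ?thesis using F by simp
  qed
  then have "(\<integral>\<^sup>+x. ennreal (min 1 (F x)) \<partial>lborel)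
    = (\<integral>\<^sup>+x. \<integral>\<^sup>+t. indicator {0<..<1} t * indicator {x. t < F x} x \<partial>lborel \<partial>lborel)"
    by simp
  also have "\<dots> = (\<integral>\<^sup>+t. \<integral>\<^sup>+x. indicator {0<..<1} t * indicator {x. t < F x} x \<partial>lborel \<partial>lborel)"
    by (rule lborel_pair.Fubini') (auto simp: indicator_def[abs_def] case_prod_beta)
  also have "\<dots> = (\<integral>\<^sup>+t. indicator {0<..<1} t * emeasure lborel {x. t < F x} \<partial>lborel)"
    by (intro nn_integral_cong) (auto simp: nn_integral_cmult)
  finally show ?thesis .
qed

text \<open>
  After normalising \<open>f\<close> and \<open>g\<close> to supremum one, each level set of \<open>h\<close> contains the corresponding
  combination of level sets of \<open>f\<close> and \<open>g\<close>, both nonempty below level one. Integrating the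
  Brunn-Minkowski inequality over the levels gives an arithmetic mean of the two integrals, which
  dominates the geometric mean.
\<close>
theorem prekopa_leindler_real:
  fixes f g h :: "real \<Rightarrow> real"
  assumes meas[measurable]: "f \<in> borel_measurable borel" "g \<in> borel_measurable borel" "h \<in> borel_measurable borel"
    and int: "integrable lborel f" "integrable lborel g" "integrable lborel h"
    and nonneg: "\<And>x. 0 \<le> f x" "\<And>x. 0 \<le> g x" "\<And>x. 0 \<le> h x"
    and bdd: "\<And>x. f x \<le> K" "\<And>x. g x \<le> K"
    and l: "0 < l" "l < 1"
    and le: "\<And>x y. f x powr (1 - l) * g y powr l \<le> h ((1 - l) * x + l * y)"
  shows "(\<integral>x. f x \<partial>lborel) powr (1 - l) * (\<integral>x. g x \<partial>lborel) powr l \<le> (\<integral>x. h x \<partial>lborel)"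
proof (cases "(\<integral>x. f x \<partial>lborel) = 0 \<or> (\<integral>x. g x \<partial>lborel) = 0")
  case True
  then show ?thesis using nonneg by auto
next
  case False
  have If: "(\<integral>x. f x \<partial>lborel) > 0" and Ig: "(\<integral>x. g x \<partial>lborel) > 0"
    using False nonneg by (auto simp: less_le)
  define a where "a = Sup (range f)"
  define b where "b = Sup (range g)"
  have fa: "f x \<le> a" for x unfolding a_def using bdd by (intro cSup_upper bdd_aboveI[of _ K]) auto
  have gb: "g x \<le> b" for x unfolding b_def using bdd by (intro cSup_upper bdd_aboveI[of _ K]) auto
  have a: "a > 0"
  proof (rule ccontr)
    assume "\<not> 0 < a"
    then have "f = (\<lambda>_. 0)" using fa nonneg(1) by (intro ext) (smt (verit))
    then show False using If by simp
  qed
  have b: "b > 0"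
  proof (rule ccontr)
    assume "\<not> 0 < b"
    then have "g = (\<lambda>_. 0)" using gb nonneg(2) by (intro ext) (smt (verit))
    then show False using Ig by simp
  qed
  define c where "c = a powr (1 - l) * b powr l"
  have c: "c > 0" using a b by (simp add: c_def)
  define F where "F x = f x / a" for x
  define G where "G x = g x / b" for x
  define H where "H x = h x / c" for x
  have [measurable]: "F \<in> borel_measurable borel" "G \<in> borel_measurable borel" "H \<in> borel_measurable borel"
    unfolding F_def[abs_def] G_def[abs_def] H_def[abs_def] by measurable
  have FGH: "0 \<le> F x" "0 \<le> G x" "0 \<le> H x" "F x \<le> 1" "G x \<le> 1" for x
    using nonneg a b c fa gb by (auto simp: F_def G_def H_def)
  have intFGH: "integrable lborel F" "integrable lborel G" "integrable lborel H"
    unfolding F_def[abs_def] G_def[abs_def] H_def[abs_def] using int by auto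
  have level: "ennreal (1 - l) * emeasure lborel {x. t < F x} + ennreal l * emeasure lborel {x. t < G x}
      \<le> emeasure lborel {x. t < H x}" if t: "0 < t" "t < 1" for t
  proof (rule brunn_minkowski_real[OF _ _ _ _ _ l])
    have "\<exists>y\<in>range f. t * a < y"
      by (rule less_cSupD) (use t a in \<open>auto simp: a_def[symmetric]\<close>)
    then show "{x. t < F x} \<noteq> {}"
      using a by (auto simp: F_def field_simps)
    have "\<exists>y\<in>range g. t * b < y"
      by (rule less_cSupD) (use t b in \<open>auto simp: b_def[symmetric]\<close>)
    then show "{x. t < G x} \<noteq> {}"
      using b by (auto simp: G_def field_simps)
    fix x y assume xy: "x \<in> {x. t < F x}" "y \<in> {x. t < G x}"
    have "t = t powr (1 - l) * t powr l"
      using t by (simp add: powr_add[symmetric])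
    also have "\<dots> < F x powr (1 - l) * G y powr l"
      using t l xy by (intro mult_strict_mono powr_less_mono2) auto
    also have "\<dots> = f x powr (1 - l) * g y powr l / c"
      using nonneg a b by (simp add: F_def G_def c_def powr_divide)
    also have "\<dots> \<le> H ((1 - l) * x + l * y)"
      unfolding H_def using le c by (intro divide_right_mono) auto
    finally show "(1 - l) * x + l * y \<in> {x. t < H x}" by simp
  qed auto
  have "ennreal ((1 - l) * (\<integral>x. F x \<partial>lborel) + l * (\<integral>x. G x \<partial>lborel))
    = ennreal (1 - l) * (\<integral>\<^sup>+x. ennreal (F x) \<partial>lborel) + ennreal l * (\<integral>\<^sup>+x. ennreal (G x) \<partial>lborel)"
    using l FGH intFGH by (subst (1 2) nn_integral_eq_integral) (auto simp: ennreal_mult)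
  also have "\<dots> = ennreal (1 - l) * (\<integral>\<^sup>+x. ennreal (min 1 (F x)) \<partial>lborel) + ennreal l * (\<integral>\<^sup>+x. ennreal (min 1 (G x)) \<partial>lborel)"
    using FGH by (simp add: min_absorb2)
  also have "\<dots> = (\<integral>\<^sup>+t. ennreal (1 - l) * (indicator {0<..<1} t * emeasure lborel {x. t < F x})
      + ennreal l * (indicator {0<..<1} t * emeasure lborel {x. t < G x}) \<partial>lborel)"
    by (subst (1 2) layer_cake_unit) (auto simp: FGH nn_integral_add nn_integral_cmult)
  also have "\<dots> \<le> (\<integral>\<^sup>+t. indicator {0<..<1} t * emeasure lborel {x. t < H x} \<partial>lborel)"
    using level by (intro nn_integral_mono) (auto split: split_indicator)
  also have "\<dots> = (\<integral>\<^sup>+x. ennreal (min 1 (H x)) \<partial>lborel)"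
    by (rule layer_cake_unit[symmetric]) (auto simp: FGH)
  also have "\<dots> \<le> (\<integral>\<^sup>+x. ennreal (H x) \<partial>lborel)"
    by (intro nn_integral_mono ennreal_leI) auto
  also have "\<dots> = ennreal (\<integral>x. H x \<partial>lborel)"
    using FGH intFGH by (intro nn_integral_eq_integral) auto
  finally have *: "(1 - l) * (\<integral>x. F x \<partial>lborel) + l * (\<integral>x. G x \<partial>lborel) \<le> (\<integral>x. H x \<partial>lborel)"
    using FGH by (subst (asm) ennreal_le_iff) auto
  have "(\<integral>x. F x \<partial>lborel) powr (1 - l) * (\<integral>x. G x \<partial>lborel) powr l
    \<le> (1 - l) * (\<integral>x. F x \<partial>lborel) + l * (\<integral>x. G x \<partial>lborel)"
    using If Ig a b l by (intro Youngs_inequality_0) (auto simp: F_def G_def)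
  also note *
  finally have "(\<integral>x. f x \<partial>lborel) powr (1 - l) * (\<integral>x. g x \<partial>lborel) powr l / c \<le> (\<integral>x. h x \<partial>lborel) / c"
    using If Ig a b by (simp add: F_def G_def H_def powr_divide c_def)
  then show ?thesis using c by (simp add: divide_le_cancel)
qed

section \<open>Lebesgue measure on real vectors\<close>

lemma measurable_vec_lambda [measurable]:
  "(\<lambda>y. vec_lambda y :: real ^ 'n) \<in> PiM UNIV (\<lambda>_. borel) \<rightarrow>\<^sub>M borel"
proof (subst borel_measurable_euclidean_space, intro ballI)
  fix b :: "real ^ 'n" assume "b \<in> Basis"
  then obtain i where b: "b = axis i 1" by (auto simp: Basis_vec_def)
  have "(\<lambda>y. vec_lambda y \<bullet> b) = (\<lambda>y. y i)"
    by (auto simp: b inner_axis fun_eq_iff)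
  then show "(\<lambda>y. vec_lambda y \<bullet> b) \<in> borel_measurable (PiM UNIV (\<lambda>_. borel))"
    by simp
qed

lemma in_Basis_vec: "b \<in> (Basis :: (real ^ 'n) set) \<Longrightarrow> \<exists>i. b = axis i 1"
  by (auto simp: Basis_vec_def)

lemma measurable_vec_lambda_sets:
  assumes "\<And>i. sets (M i) = sets borel"
  shows "(\<lambda>y. vec_lambda y :: real ^ 'n) \<in> PiM UNIV M \<rightarrow>\<^sub>M borel"
  using measurable_vec_lambda sets_PiM_cong[OF refl, of UNIV M "\<lambda>_. borel"] assms
  by (metis measurable_cong_sets)

interpretation lborel_product: product_sigma_finite "\<lambda>_. lborel :: real measure"
  by standard

text \<open>
  Realising Lebesgue measure on vectors as an image of a product over the index type makes
  Fubini's theorem in a single coordinate available.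
\<close>
lemma lborel_vec_eq_distr:
  "(lborel :: (real ^ 'n) measure) = distr (PiM UNIV (\<lambda>_. lborel)) borel vec_lambda"
proof (rule lborel_eqI)
  fix l u :: "real ^ 'n" assume lu: "\<And>b. b \<in> Basis \<Longrightarrow> l \<bullet> b \<le> u \<bullet> b"
  have lu': "l $ i \<le> u $ i" for i
    using lu[of "axis i 1"] by (auto simp: inner_axis)
  have "emeasure (distr (PiM UNIV (\<lambda>_. lborel)) borel vec_lambda) (box l u)
    = emeasure (PiM UNIV (\<lambda>_. lborel)) (PiE UNIV (\<lambda>i. {l $ i<..<u $ i}))"
    by (subst emeasure_distr)
       (auto simp: measurable_vec_lambda_sets space_PiM PiE_iff mem_box_cart intro!: arg_cong2[where f=emeasure])
  also have "\<dots> = (\<Prod>i\<in>UNIV. ennreal (u $ i - l $ i))"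
    by (subst lborel_product.emeasure_PiM) (auto simp: lu')
  also have "\<dots> = ennreal (\<Prod>i\<in>UNIV. u $ i - l $ i)"
    by (rule prod_ennreal) (use lu' in auto)
  also have "(\<Prod>i\<in>UNIV. u $ i - l $ i) = (\<Prod>b\<in>Basis. (u - l) \<bullet> b)"
    by (subst Basis_vec_def, subst prod.UNION_disjoint) 
       (auto simp: axis_eq_axis inner_axis)
  finally show "emeasure (distr (PiM UNIV (\<lambda>_. lborel)) borel vec_lambda) (box l u)
    = ennreal (\<Prod>b\<in>Basis. (u - l) \<bullet> b)" .
qed simp

lemma nn_integral_lborel_vec:
  fixes f :: "real ^ 'n \<Rightarrow> ennreal"
  assumes "f \<in> borel_measurable borel"
  shows "(\<integral>\<^sup>+x. f x \<partial>lborel) = (\<integral>\<^sup>+y. f (vec_lambda y) \<partial>PiM UNIV (\<lambda>_. lborel))"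
  by (subst lborel_vec_eq_distr, subst nn_integral_distr) (auto simp: assms measurable_vec_lambda_sets)

lemma nn_integral_lborel_vec_prod:
  fixes g :: "'n :: finite \<Rightarrow> real \<Rightarrow> ennreal"
  assumes [measurable]: "\<And>i. g i \<in> borel_measurable borel"
  shows "(\<integral>\<^sup>+x. (\<Prod>i\<in>UNIV. g i (x $ i)) \<partial>(lborel :: (real ^ 'n) measure)) = (\<Prod>i\<in>UNIV. \<integral>\<^sup>+y. g i y \<partial>lborel)"
  by (subst nn_integral_lborel_vec) (auto simp: lborel_product.product_nn_integral_prod)

section \<open>Linear change of variables\<close>

lemma measurable_matrix_vector_mult [measurable]:
  "(\<lambda>x. (A :: real ^ 'n ^ 'm) *v x) \<in> borel \<rightarrow>\<^sub>M borel"
  by (intro borel_measurable_continuous_onI linear_continuous_on matrix_vector_mul_bounded_linear)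

text \<open>
  For fixed values of the other coordinates the shear is a translation in coordinate \<open>m\<close>.
\<close>
lemma nn_integral_lborel_shear:
  fixes f :: "real ^ 'n \<Rightarrow> ennreal"
  assumes [measurable]: "f \<in> borel_measurable borel" and mn: "m \<noteq> n"
  shows "(\<integral>\<^sup>+x. f (\<chi> i. if i = m then x $ m + x $ n else x $ i) \<partial>lborel) = (\<integral>\<^sup>+x. f x \<partial>lborel)"
proof -
  have U: "(UNIV :: 'n set) = insert m (UNIV - {m})" by auto
  have meas: "(\<lambda>x. f (vec_lambda x)) \<in> borel_measurable (PiM (insert m (UNIV - {m})) (\<lambda>_. lborel))"
    unfolding U[symmetric] by (intro measurable_compose[OF measurable_vec_lambda_sets]) auto
  have S: "(\<lambda>x::real^'n. \<chi> i. if i = m then x $ m + x $ n else x $ i) \<in> borel \<rightarrow>\<^sub>M borel"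
  proof -
    have "linear (\<lambda>x::real^'n. (\<chi> i. if i = m then x $ m + x $ n else x $ i) :: real ^ 'n)"
      by (auto simp: linear_iff vec_eq_iff algebra_simps)
    then show ?thesis
      by (intro borel_measurable_continuous_onI linear_continuous_on) (simp add: linear_conv_bounded_linear)
  qed
  have measS: "(\<lambda>x. f (\<chi> i. if i = m then vec_lambda x $ m + vec_lambda x $ n else vec_lambda x $ i)) \<in>
     borel_measurable (PiM (insert m (UNIV - {m})) (\<lambda>_. lborel))"
    unfolding U[symmetric]
    by (intro measurable_compose[OF measurable_vec_lambda_sets measurable_compose[OF S]]) auto
  have "(\<integral>\<^sup>+x. f (\<chi> i. if i = m then x $ m + x $ n else x $ i) \<partial>lborel)
    = (\<integral>\<^sup>+x. f (\<chi> i. if i = m then vec_lambda x $ m + vec_lambda x $ n else vec_lambda x $ i) \<partial>PiM UNIV (\<lambda>_. lborel))"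
    by (rule nn_integral_lborel_vec) (intro measurable_compose[OF S], simp)
  also have "\<dots> = (\<integral>\<^sup>+x. \<integral>\<^sup>+y. f (\<chi> i. if i = m then y + x n else x i) \<partial>lborel \<partial>PiM (UNIV - {m}) (\<lambda>_. lborel))"
    by (subst U, subst lborel_product.product_nn_integral_insert)
       (use measS mn in \<open>auto intro!: nn_integral_cong arg_cong[where f=f] simp: vec_eq_iff\<close>)
  also have "\<dots> = (\<integral>\<^sup>+x. \<integral>\<^sup>+y. f (\<chi> i. if i = m then y else x i) \<partial>lborel \<partial>PiM (UNIV - {m}) (\<lambda>_. lborel))"
  proof (rule nn_integral_cong)
    fix x :: "'n \<Rightarrow> real"
    have "(\<lambda>y. (\<chi> i. if i = m then y else x i) :: real ^ 'n) \<in> borel \<rightarrow>\<^sub>M borel"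
      by (intro borel_measurable_continuous_onI continuous_on_vec_lambda, rename_tac i, case_tac "i = m") auto
    then have "(\<lambda>y. f (\<chi> i. if i = m then y else x i)) \<in> borel_measurable borel"
      by measurable
    from nn_integral_real_affine[OF this, of 1 "x n"]
    show "(\<integral>\<^sup>+y. f (\<chi> i. if i = m then y + x n else x i) \<partial>lborel) = (\<integral>\<^sup>+y. f (\<chi> i. if i = m then y else x i) \<partial>lborel)"
      by (simp add: add.commute cong: if_cong)
  qed
  also have "\<dots> = (\<integral>\<^sup>+x. f (vec_lambda x) \<partial>PiM UNIV (\<lambda>_. lborel))"
    by (subst (2) U, subst lborel_product.product_nn_integral_insert)
       (use meas in \<open>auto intro!: nn_integral_cong arg_cong[where f=f] simp: vec_eq_iff\<close>)
  also have "\<dots> = (\<integral>\<^sup>+x. f x \<partial>lborel)"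
    by (rule nn_integral_lborel_vec[symmetric]) simp
  finally show ?thesis .
qed

lemma nn_integral_lborel_permute:
  fixes f :: "real ^ 'n \<Rightarrow> ennreal"
  assumes [measurable]: "f \<in> borel_measurable borel" and p: "bij (p :: 'n \<Rightarrow> 'n)"
  shows "(\<integral>\<^sup>+x. f (\<chi> i. x $ p i) \<partial>lborel) = (\<integral>\<^sup>+x. f x \<partial>lborel)"
proof -
  have S: "(\<lambda>x::real^'n. \<chi> i. x $ p i) \<in> lborel \<rightarrow>\<^sub>M borel"
    by (simp, intro borel_measurable_continuous_onI continuous_on_vec_lambda) (auto intro!: continuous_intros)
  have "lborel = distr lborel borel (\<lambda>x::real^'n. \<chi> i. x $ p i)"
  proof (rule lborel_eqI)
    fix l u :: "real ^ 'n" assume lu: "\<And>b. b \<in> Basis \<Longrightarrow> l \<bullet> b \<le> u \<bullet> b"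
    have lu': "l $ i \<le> u $ i" for i
      using lu[of "axis i 1"] by (auto simp: inner_axis)
    have B: "(\<Prod>b\<in>Basis. (u - l) \<bullet> b) = (\<Prod>i\<in>UNIV. u $ i - l $ i)" for u l :: "real ^ 'n"
      by (subst Basis_vec_def, subst prod.UNION_disjoint) (auto simp: axis_eq_axis inner_axis)
    have pp: "p (inv p i) = i" "inv p (p i) = i" for i using p by (auto simp: bij_is_surj surj_f_inv_f bij_is_inj)
    have all: "(\<forall>i. Q i (p i)) \<longleftrightarrow> (\<forall>i. Q (inv p i) i)" for Q by (metis pp)
    have "(\<lambda>x::real^'n. \<chi> i. x $ p i) -` box l u = box (\<chi> i. l $ inv p i) (\<chi> i. u $ inv p i)"
      using all[of "\<lambda>i j. l $ i < x $ j \<and> x $ j < u $ i" for x] by (simp add: set_eq_iff mem_box_cart)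
    then have "emeasure (distr lborel borel (\<lambda>x::real^'n. \<chi> i. x $ p i)) (box l u)
      = emeasure lborel (box (\<chi> i. l $ inv p i) (\<chi> i. u $ inv p i))"
      by (subst emeasure_distr[OF S]) simp_all
    also have "\<dots> = ennreal (\<Prod>i\<in>UNIV. u $ inv p i - l $ inv p i)"
      by (subst emeasure_lborel_box) (auto simp: B lu' inner_axis dest!: in_Basis_vec)
    also have "(\<Prod>i\<in>UNIV. u $ inv p i - l $ inv p i) = (\<Prod>i\<in>UNIV. u $ i - l $ i)"
      by (rule prod.reindex_bij_betw) (use p bij_imp_bij_inv in auto)
    finally show "emeasure (distr lborel borel (\<lambda>x::real^'n. \<chi> i. x $ p i)) (box l u)
      = ennreal (\<Prod>b\<in>Basis. (u - l) \<bullet> b)" by (simp add: B)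
  qed simp
  then show ?thesis
    using nn_integral_distr[OF S, of f] by simp
qed

lemma nn_integral_lborel_diagonal:
  fixes f :: "real ^ 'n \<Rightarrow> ennreal"
  assumes [measurable]: "f \<in> borel_measurable borel" and c: "\<And>i. c i \<noteq> 0"
  shows "(\<integral>\<^sup>+x. f x \<partial>lborel) = ennreal (\<Prod>i\<in>UNIV. \<bar>c i\<bar>) * (\<integral>\<^sup>+x. f (\<chi> i. c i * x $ i) \<partial>lborel)"
proof -
  define c' :: "real ^ 'n \<Rightarrow> real" where "c' b = (\<chi> i. c i) \<bullet> b" for b
  have c': "c' (axis i 1) = c i" for i by (simp add: c'_def inner_axis)
  have T: "(0 + (\<Sum>j\<in>Basis. (c' j * (x \<bullet> j)) *\<^sub>R j)) = (\<chi> i. c i * x $ i)" for x :: "real ^ 'n"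
  proof -
    have "(\<Sum>j\<in>Basis. (c' j * (x \<bullet> j)) *\<^sub>R j) = (\<Sum>i\<in>UNIV. (c i * x $ i) *\<^sub>R axis i 1)"
      by (subst Basis_vec_def, subst sum.UNION_disjoint) (auto simp: axis_eq_axis inner_axis c')
    then show ?thesis
      by (simp add: vec_eq_iff axis_def if_distrib[of "\<lambda>x. _ * x"] cong: if_cong)
  qed
  have P: "(\<Prod>j\<in>Basis. \<bar>c' j\<bar>) = (\<Prod>i\<in>UNIV. \<bar>c i\<bar>)"
    by (subst Basis_vec_def, subst prod.UNION_disjoint) (auto simp: axis_eq_axis c')
  have S: "(\<lambda>x::real^'n. \<chi> i. c i * x $ i) \<in> lborel \<rightarrow>\<^sub>M borel"
    by (simp, intro borel_measurable_continuous_onI continuous_on_vec_lambda) (auto intro!: continuous_intros)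
  have "lborel = density (distr lborel borel (\<lambda>x::real^'n. 0 + (\<Sum>j\<in>Basis. (c' j * (x \<bullet> j)) *\<^sub>R j))) (\<lambda>_. \<Prod>j\<in>Basis. \<bar>c' j\<bar>)"
    by (rule lborel_affine_euclidean) (auto simp: Basis_vec_def c' c)
  then have E: "lborel = density (distr lborel borel (\<lambda>x::real^'n. \<chi> i. c i * x $ i)) (\<lambda>_. ennreal (\<Prod>i\<in>UNIV. \<bar>c i\<bar>))"
    unfolding T P .
  show ?thesis
    by (subst E) (simp add: nn_integral_density nn_integral_cmult nn_integral_distr[OF S])
qed

text \<open>
  Both sides are multiplicative in \<open>A\<close>, so it is enough to treat elementary matrices: scalings of
  the axes, transpositions of two coordinates and shears.
\<close>
theorem nn_integral_lborel_linear:
  fixes A :: "real ^ 'n ^ 'n" and f :: "real ^ 'n \<Rightarrow> ennreal"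
  assumes "det A \<noteq> 0" "f \<in> borel_measurable borel"
  shows "(\<integral>\<^sup>+x. f x \<partial>lborel) = ennreal \<bar>det A\<bar> * (\<integral>\<^sup>+x. f (A *v x) \<partial>lborel)"
proof -
  have "\<forall>f. det A \<noteq> 0 \<longrightarrow> f \<in> borel_measurable borel \<longrightarrow>
    (\<integral>\<^sup>+x. f x \<partial>lborel) = ennreal \<bar>det A\<bar> * (\<integral>\<^sup>+x. f (A *v x) \<partial>lborel)"
  proof (induction A rule: induct_matrix_elementary_alt)
    case (1 A B)
    show ?case
    proof (intro allI impI)
      fix f :: "real ^ 'n \<Rightarrow> ennreal" assume d: "det (A ** B) \<noteq> 0" and f[measurable]: "f \<in> borel_measurable borel"
      have dd: "det A \<noteq> 0" "det B \<noteq> 0" using d by (auto simp: det_mul)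
      have "(\<integral>\<^sup>+x. f x \<partial>lborel) = ennreal \<bar>det A\<bar> * (\<integral>\<^sup>+x. f (A *v x) \<partial>lborel)"
        using 1(1) dd f by blast
      also have "(\<integral>\<^sup>+x. f (A *v x) \<partial>lborel) = ennreal \<bar>det B\<bar> * (\<integral>\<^sup>+x. f (A *v (B *v x)) \<partial>lborel)"
        using 1(2) dd measurable_compose[OF measurable_matrix_vector_mult f] by blast
      finally show "(\<integral>\<^sup>+x. f x \<partial>lborel) = ennreal \<bar>det (A ** B)\<bar> * (\<integral>\<^sup>+x. f (A ** B *v x) \<partial>lborel)"
        by (simp add: det_mul abs_mult ennreal_mult mult.assoc matrix_vector_mul_assoc)
    qed
  next
    case (2 A i)
    then show ?case by (simp add: det_zero_row)
  next
    case (3 A)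
    have dA: "det A = (\<Prod>i\<in>UNIV. A $ i $ i)" using 3 by (rule det_diagonal)
    have "A *v x = (\<chi> i. A $ i $ i * x $ i)" for x
    proof -
      have "(\<Sum>j\<in>UNIV. A $ i $ j * x $ j) = (\<Sum>j\<in>UNIV. if j = i then A $ i $ i * x $ i else 0)" for i
        by (intro sum.cong) (auto simp: 3)
      then show ?thesis by (simp add: matrix_vector_mult_def)
    qed
    then show ?case
      using nn_integral_lborel_diagonal[of _ "\<lambda>i. A $ i $ i"] by (auto simp: dA abs_prod)
  next
    case (4 m n)
    let ?p = "Transposition.transpose m n"
    have "det (\<chi> i j. mat 1 $ i $ ?p j :: real ^ 'n ^ 'n) = of_int (sign ?p) * det (mat 1 :: real ^ 'n ^ 'n)"
      by (rule det_permute_columns) (simp add: permutes_swap_id)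
    then have d: "\<bar>det (\<chi> i j. mat 1 $ i $ ?p j :: real ^ 'n ^ 'n)\<bar> = 1"
      by (simp add: sign_def)
    have "(\<chi> i j. mat 1 $ i $ ?p j :: real ^ 'n ^ 'n) *v x = (\<chi> i. x $ ?p i)" for x
    proof -
      have "(\<Sum>j\<in>UNIV. (if i = ?p j then 1 else 0) * x $ j) = x $ ?p i" for i
      proof -
        have "(\<Sum>j\<in>UNIV. (if i = ?p j then 1 else 0) * x $ j) = (\<Sum>j\<in>UNIV. if j = ?p i then x $ j else 0)"
          by (intro sum.cong) (auto simp: transpose_involutory)
        then show ?thesis by simp
      qed
      then show ?thesis by (simp add: matrix_vector_mult_def mat_def)
    qed
    then show ?case
      using nn_integral_lborel_permute[of _ ?p] d by (simp add: bij_swap)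
  next
    case (5 m n)
    let ?E = "\<chi> i j. of_bool (i = m \<and> j = n \<or> i = j) :: real ^ 'n ^ 'n"
    have E: "?E = (\<chi> k. if k = m then row m (mat 1) + 1 *s row n (mat 1) else row k (mat 1))"
      using 5 by (auto simp: vec_eq_iff row_def mat_def)
    have "det (\<chi> k. if k = m then row m (mat 1 :: real ^ 'n ^ 'n) + 1 *s row n (mat 1) else row k (mat 1)) = det (mat 1 :: real ^ 'n ^ 'n)"
      by (rule det_row_operation[OF 5])
    then have "det ?E = 1"
      by (simp only: E det_I)
    moreover have "?E *v x = (\<chi> i. if i = m then x $ m + x $ n else x $ i)" for x
    proof -
      have "(\<Sum>j\<in>UNIV. of_bool (i = m \<and> j = n \<or> i = j) * x $ j) = (if i = m then x $ m + x $ n else x $ i)" for i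
      proof -
        have "(\<Sum>j\<in>UNIV. of_bool (i = m \<and> j = n \<or> i = j) * x $ j)
          = (\<Sum>j\<in>UNIV. (if j = i then x $ j else 0) + (if i = m then if j = n then x $ j else 0 else 0))"
          using 5 by (intro sum.cong) auto
        then show ?thesis by (simp add: sum.distrib)
      qed
      then show ?thesis by (simp add: matrix_vector_mult_def)
    qed
    ultimately show ?case
      using nn_integral_lborel_shear[OF _ 5] by simp
  qed
  then show ?thesis using assms by blast
qed

section \<open>The standard normal vector\<close>

definition replace_coord :: "'n \<Rightarrow> real \<Rightarrow> real ^ 'n \<Rightarrow> real ^ 'n" where
  "replace_coord k y x = (\<chi> i. if i = k then y else x $ i)"

lemma replace_coord_nth [simp]: "replace_coord k y x $ i = (if i = k then y else x $ i)"
  by (simp add: replace_coord_def)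

lemma measurable_replace_coord [measurable]:
  fixes k :: "'n :: finite"
  shows "(\<lambda>(x, y). replace_coord k y x) \<in> borel \<Otimes>\<^sub>M borel \<rightarrow>\<^sub>M borel"
proof -
  have "continuous_on UNIV (\<lambda>p :: (real ^ 'n) \<times> real. replace_coord k (snd p) (fst p))"
    unfolding replace_coord_def
    by (intro continuous_on_vec_lambda, rename_tac i, case_tac "i = k") (auto intro!: continuous_intros)
  then have "(\<lambda>p :: (real ^ 'n) \<times> real. replace_coord k (snd p) (fst p)) \<in> borel \<rightarrow>\<^sub>M borel"
    by (rule borel_measurable_continuous_onI)
  then show ?thesis by (simp add: borel_prod case_prod_beta)
qed

lemma measurable_replace_coord1 [measurable]: "(\<lambda>y. replace_coord k y x) \<in> borel \<rightarrow>\<^sub>M borel"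
  using measurable_compose[OF measurable_Pair1'[of x borel borel] measurable_replace_coord[of k]] by simp

interpretation std_normal: prob_space std_normal_distribution
  by (rule prob_space_normal_density) simp

lemma std_normal_UNIV [simp]: "measure std_normal_distribution UNIV = 1"
  using std_normal.prob_space by simp

interpretation std_normal_product: product_sigma_finite "\<lambda>_. std_normal_distribution"
  by standard

definition std_normal_vec :: "(real ^ 'n) measure" where
  "std_normal_vec = distr (PiM UNIV (\<lambda>_. std_normal_distribution)) borel vec_lambda"

lemma measurable_vec_std: "(\<lambda>y. vec_lambda y :: real ^ 'n) \<in> PiM UNIV (\<lambda>_. std_normal_distribution) \<rightarrow>\<^sub>M borel"
  by (rule measurable_vec_lambda_sets) simp

lemma sets_std_normal_vec [simp, measurable_cong]: "sets std_normal_vec = sets borel"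
  and space_std_normal_vec [simp]: "space std_normal_vec = UNIV"
  by (simp_all add: std_normal_vec_def)

lemma prob_space_std_normal_vec: "prob_space (std_normal_vec :: (real ^ 'n) measure)"
  unfolding std_normal_vec_def
  by (intro prob_space.prob_space_distr measurable_vec_std prob_space_PiM std_normal.prob_space_axioms)

interpretation std_normal_vec: prob_space "std_normal_vec :: (real ^ 'n) measure"
  by (rule prob_space_std_normal_vec)

lemma std_normal_vec_density:
  "(std_normal_vec :: (real ^ 'n) measure) = density lborel (\<lambda>x. \<Prod>i\<in>UNIV. ennreal (std_normal_density (x $ i)))"
proof -
  have "density (PiM UNIV (\<lambda>_::'n. lborel)) (\<lambda>y. \<Prod>i\<in>UNIV. ennreal (std_normal_density (y i))) = PiM UNIV (\<lambda>_. std_normal_distribution)"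
  proof (rule std_normal_product.PiM_eqI)
    show "sets (density (PiM UNIV (\<lambda>_::'n. lborel)) (\<lambda>y. \<Prod>i\<in>UNIV. ennreal (std_normal_density (y i)))) = sets (PiM UNIV (\<lambda>_. std_normal_distribution))"
      unfolding sets_density by (intro sets_PiM_cong) auto
    fix A :: "'n \<Rightarrow> real set" assume A: "\<And>i. i \<in> UNIV \<Longrightarrow> A i \<in> sets std_normal_distribution"
    have "PiE UNIV A \<in> sets (PiM UNIV (\<lambda>_::'n. lborel :: real measure))"
      using A by (intro sets_PiM_I_finite) auto
    then have "emeasure (density (PiM UNIV (\<lambda>_::'n. lborel)) (\<lambda>y. \<Prod>i\<in>UNIV. ennreal (std_normal_density (y i)))) (PiE UNIV A)
      = (\<integral>\<^sup>+y. (\<Prod>i\<in>UNIV. ennreal (std_normal_density (y i))) * indicator (PiE UNIV A) y \<partial>PiM UNIV (\<lambda>_. lborel))"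
      by (intro emeasure_density) auto
    also have "\<dots> = (\<integral>\<^sup>+y. (\<Prod>i\<in>UNIV. ennreal (std_normal_density (y i)) * indicator (A i) (y i)) \<partial>PiM UNIV (\<lambda>_. lborel))"
      by (intro nn_integral_cong) (auto simp: prod.distrib indicator_def PiE_iff prod_zero_iff)
    also have "\<dots> = (\<Prod>i\<in>UNIV. \<integral>\<^sup>+y. ennreal (std_normal_density y) * indicator (A i) y \<partial>lborel)"
      using A by (intro lborel_product.product_nn_integral_prod) auto
    also have "\<dots> = (\<Prod>i\<in>UNIV. emeasure std_normal_distribution (A i))"
      using A by (intro prod.cong emeasure_density[symmetric]) auto
    finally show "emeasure (density (PiM UNIV (\<lambda>_::'n. lborel)) (\<lambda>y. \<Prod>i\<in>UNIV. ennreal (std_normal_density (y i)))) (PiE UNIV A)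
      = (\<Prod>i\<in>UNIV. emeasure std_normal_distribution (A i))" .
  qed simp
  note E = this
  have "(std_normal_vec :: (real ^ 'n) measure)
    = distr (density (PiM UNIV (\<lambda>_::'n. lborel)) (\<lambda>y. \<Prod>i\<in>UNIV. ennreal (std_normal_density ((vec_lambda y :: real ^ 'n) $ i)))) borel vec_lambda"
    by (simp add: std_normal_vec_def E)
  also have "\<dots> = density (distr (PiM UNIV (\<lambda>_::'n. lborel)) borel vec_lambda) (\<lambda>x. \<Prod>i\<in>UNIV. ennreal (std_normal_density (x $ i)))"
    by (rule density_distr[symmetric]) (auto simp: measurable_vec_lambda_sets)
  finally show ?thesis by (simp add: lborel_vec_eq_distr[symmetric])
qed

lemma borel_measurable_coord_average:
  fixes f :: "real ^ 'n \<Rightarrow> real"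
  assumes [measurable]: "f \<in> borel_measurable borel"
  shows "(\<lambda>x. \<integral>y. f (replace_coord k y x) \<partial>std_normal_distribution) \<in> borel_measurable borel"
proof (rule std_normal.borel_measurable_lebesgue_integral)
  have "(\<lambda>p. f (case p of (x, y) \<Rightarrow> replace_coord k y x)) \<in> borel_measurable (borel \<Otimes>\<^sub>M borel)"
    by measurable
  then show "(\<lambda>(x, y). f (replace_coord k y x)) \<in> borel_measurable (borel \<Otimes>\<^sub>M std_normal_distribution)"
    by (simp add: case_prod_beta cong: measurable_cong_sets)
qed

text \<open>
  Resampling one coordinate independently does not change the law of a standard normal vector.
\<close>
lemma integral_std_normal_vec_coord:
  fixes f :: "real ^ 'n \<Rightarrow> real"
  assumes [measurable]: "f \<in> borel_measurable borel" and f: "\<And>x. \<bar>f x\<bar> \<le> c"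
  shows "(\<integral>x. f x \<partial>std_normal_vec)
    = (\<integral>x. (\<integral>y. f (replace_coord k y x) \<partial>std_normal_distribution) \<partial>std_normal_vec)"
proof -
  have U: "(UNIV :: 'n set) = insert k (UNIV - {k})" by auto
  have red: "(\<integral>x. g x \<partial>std_normal_vec) = (\<integral>x. \<integral>y. g (\<chi> i. if i = k then y else x i) \<partial>std_normal_distribution \<partial>PiM (UNIV - {k}) (\<lambda>_. std_normal_distribution))"
    if g[measurable]: "g \<in> borel_measurable borel" and gc: "\<And>x. \<bar>g x\<bar> \<le> c" for g :: "real ^ 'n \<Rightarrow> real"
  proof -
    have "(\<integral>x. g x \<partial>std_normal_vec) = (\<integral>y. g (vec_lambda y) \<partial>PiM UNIV (\<lambda>_. std_normal_distribution))"
      unfolding std_normal_vec_def by (rule integral_distr[OF measurable_vec_std]) simp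
    also have "\<dots> = (\<integral>x. \<integral>y. g (vec_lambda (x(k := y))) \<partial>std_normal_distribution \<partial>PiM (UNIV - {k}) (\<lambda>_. std_normal_distribution))"
    proof (subst U, rule std_normal_product.product_integral_insert)
      interpret P: prob_space "PiM UNIV (\<lambda>_::'n. std_normal_distribution)"
        by (intro prob_space_PiM std_normal.prob_space_axioms)
      have "integrable (PiM UNIV (\<lambda>_::'n. std_normal_distribution)) (\<lambda>x. g (vec_lambda x))"
        by (rule P.integrable_const_bound[where B=c])
           (auto simp: gc intro!: measurable_compose[OF measurable_vec_std])
      then show "integrable (PiM (insert k (UNIV - {k})) (\<lambda>_::'n. std_normal_distribution)) (\<lambda>x. g (vec_lambda x))"
        unfolding U[symmetric] .
    qed auto
    finally show ?thesis by (simp add: fun_upd_def)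
  qed
  let ?a = "\<lambda>x. \<integral>y. f (replace_coord k y x) \<partial>std_normal_distribution"
  have am: "?a \<in> borel_measurable borel"
    by (rule borel_measurable_coord_average) simp
  have ac: "\<bar>?a x\<bar> \<le> c" for x
  proof -
    have "0 \<le> c" using f[of 0] by linarith
    then have int: "integrable std_normal_distribution (\<lambda>y. norm (f (replace_coord k y x)))"
      by (intro std_normal.integrable_const_bound[where B=c]) (auto simp: f)
    have "norm (?a x) \<le> (\<integral>y. norm (f (replace_coord k y x)) \<partial>std_normal_distribution)" by (rule integral_norm_bound)
    also have "\<dots> \<le> (\<integral>y. c \<partial>std_normal_distribution)"
      by (intro integral_mono int) (auto simp: f)
    finally show ?thesis by (simp add: std_normal.prob_space)
  qed
  have "(\<integral>x. ?a x \<partial>std_normal_vec) = (\<integral>x. \<integral>y. ?a (\<chi> i. if i = k then y else x i) \<partial>std_normal_distribution \<partial>PiM (UNIV - {k}) (\<lambda>_. std_normal_distribution))"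
    by (rule red[OF am ac])
  also have "\<dots> = (\<integral>x. \<integral>y. f (\<chi> i. if i = k then y else x i) \<partial>std_normal_distribution \<partial>PiM (UNIV - {k}) (\<lambda>_. std_normal_distribution))"
    by (simp add: replace_coord_def std_normal.prob_space cong: if_cong)
  also have "\<dots> = (\<integral>x. f x \<partial>std_normal_vec)"
    by (rule red[symmetric]) (auto simp: f)
  finally show ?thesis by simp
qed

text \<open>
  The bound by one makes every integral against a probability measure finite. Log-concavity is
  multiplicative, with \<open>0 powr a = 0\<close>, so that zeros and hence indicators of convex sets are
  included.
\<close>
definition even_log_concave :: "(real ^ 'n \<Rightarrow> real) \<Rightarrow> bool" where
  "even_log_concave f \<longleftrightarrow> f \<in> borel_measurable borel \<and> (\<forall>x. 0 \<le> f x \<and> f x \<le> 1) \<and> (\<forall>x. f (- x) = f x) \<and>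
     (\<forall>x y l. 0 < l \<longrightarrow> l < 1 \<longrightarrow> f x powr (1 - l) * f y powr l \<le> f ((1 - l) *\<^sub>R x + l *\<^sub>R y))"

lemma std_normal_density_log_concave:
  assumes l: "0 < l" "l < 1"
  shows "std_normal_density x powr (1 - l) * std_normal_density y powr l \<le> std_normal_density ((1 - l) * x + l * y)"
proof -
  have "((1 - l) * x + l * y)\<^sup>2 \<le> (1 - l) * x\<^sup>2 + l * y\<^sup>2"
  proof -
    have "(1 - l) * x\<^sup>2 + l * y\<^sup>2 - ((1 - l) * x + l * y)\<^sup>2 = l * (1 - l) * (x - y)\<^sup>2"
      by (simp add: power2_eq_square algebra_simps)
    then show ?thesis using l by (smt (verit) mult_nonneg_nonneg zero_le_power2)
  qed
  then have "exp (- (((1 - l) * x\<^sup>2 + l * y\<^sup>2) / 2)) \<le> exp (- (((1 - l) * x + l * y)\<^sup>2 / 2))"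
    by simp
  moreover have "std_normal_density x powr (1 - l) * std_normal_density y powr l
    = 1 / sqrt (2 * pi) * exp (- (((1 - l) * x\<^sup>2 + l * y\<^sup>2) / 2))"
  proof -
    define c where "c = 1 / sqrt (2 * pi)"
    have c: "c > 0" by (simp add: c_def)
    have "std_normal_density x powr (1 - l) * std_normal_density y powr l
      = (c powr (1 - l) * c powr l) * (exp (- x\<^sup>2 / 2) powr (1 - l) * exp (- y\<^sup>2 / 2) powr l)"
      using c by (simp add: std_normal_density_def c_def[symmetric] powr_mult)
    also have "c powr (1 - l) * c powr l = c"
      using c by (simp add: powr_add[symmetric])
    also have "exp (- x\<^sup>2 / 2) powr (1 - l) * exp (- y\<^sup>2 / 2) powr l = exp (- (((1 - l) * x\<^sup>2 + l * y\<^sup>2) / 2))"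
      by (simp add: powr_def exp_add[symmetric] field_simps)
    finally show ?thesis by (simp add: c_def)
  qed
  ultimately show ?thesis by (simp add: std_normal_density_def divide_right_mono)
qed

lemma integral_std_normal_uminus:
  fixes g :: "real \<Rightarrow> real"
  assumes [measurable]: "g \<in> borel_measurable borel"
  shows "(\<integral>y. g (- y) \<partial>std_normal_distribution) = (\<integral>y. g y \<partial>std_normal_distribution)"
proof -
  have "(\<integral>y. g y \<partial>std_normal_distribution) = (\<integral>y. std_normal_density y * g y \<partial>lborel)"
    by (simp add: integral_density)
  also have "\<dots> = (\<integral>y. std_normal_density (- y) * g (- y) \<partial>lborel)"
    using lborel_integral_real_affine[of "-1" "\<lambda>y. std_normal_density y * g y" 0] by simp
  also have "\<dots> = (\<integral>y. g (- y) \<partial>std_normal_distribution)"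
    by (simp add: integral_density std_normal_density_def)
  finally show ?thesis by simp
qed

text \<open>
  Log-concavity survives because the Prekopa-Leindler inequality applies to the product of the
  normal density with \<open>f\<close> along the coordinate axis; evenness survives because the normal law is
  symmetric.
\<close>
lemma even_log_concave_average:
  fixes f :: "real ^ 'n \<Rightarrow> real"
  assumes "even_log_concave f"
  shows "even_log_concave (\<lambda>x. \<integral>y. f (replace_coord k y x) \<partial>std_normal_distribution)"
proof -
  have f[measurable]: "f \<in> borel_measurable borel" and b: "0 \<le> f x" "f x \<le> 1" and ev: "f (- x) = f x"
    and lc: "0 < l \<Longrightarrow> l < 1 \<Longrightarrow> f x powr (1 - l) * f y powr l \<le> f ((1 - l) *\<^sub>R x + l *\<^sub>R y)" for x y l
    using assms by (auto simp: even_log_concave_def)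
  let ?a = "\<lambda>x. \<integral>y. f (replace_coord k y x) \<partial>std_normal_distribution"
  have int: "integrable std_normal_distribution (\<lambda>y. f (replace_coord k y x))" for x
    by (rule std_normal.integrable_const_bound[where B=1]) (auto simp: b)
  show ?thesis unfolding even_log_concave_def
  proof (intro conjI allI impI)
    show "?a \<in> borel_measurable borel"
      by (rule borel_measurable_coord_average) simp
    fix x :: "real ^ 'n"
    show "0 \<le> ?a x" by (simp add: b)
    have "?a x \<le> (\<integral>y. 1 \<partial>std_normal_distribution)"
      by (intro integral_mono int) (auto simp: b)
    then show "?a x \<le> 1" by (simp add: std_normal_UNIV)
    have "replace_coord k y (- x) = - replace_coord k (- y) x" for y
      by (simp add: vec_eq_iff)
    then have "?a (- x) = (\<integral>y. f (replace_coord k (- y) x) \<partial>std_normal_distribution)"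
      by (simp add: ev)
    also have "\<dots> = ?a x"
      by (rule integral_std_normal_uminus) simp
    finally show "?a (- x) = ?a x" .
    fix y :: "real ^ 'n" and l :: real assume l: "0 < l" "l < 1"
    have E: "?a x = (\<integral>t. std_normal_density t * f (replace_coord k t x) \<partial>lborel)" for x
      by (simp add: integral_density)
    have I: "integrable lborel (\<lambda>t. std_normal_density t * f (replace_coord k t x))" for x
      using int[of x] by (simp add: integrable_density)
    have bd: "std_normal_density t * f (replace_coord k t x) \<le> 1 / sqrt (2 * pi)" for t and x :: "real ^ 'n"
    proof -
      have "std_normal_density t * f (replace_coord k t x) \<le> std_normal_density t * 1"
        by (intro mult_left_mono) (auto simp: b)
      also have "\<dots> \<le> 1 / sqrt (2 * pi)"
        by (simp add: std_normal_density_def divide_right_mono)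
      finally show ?thesis .
    qed
    show "?a x powr (1 - l) * ?a y powr l \<le> ?a ((1 - l) *\<^sub>R x + l *\<^sub>R y)"
      unfolding E
    proof (rule prekopa_leindler_real[OF _ _ _ I I I])
      fix s t
      show "(std_normal_density s * f (replace_coord k s x)) powr (1 - l) * (std_normal_density t * f (replace_coord k t y)) powr l
        \<le> std_normal_density ((1 - l) * s + l * t) * f (replace_coord k ((1 - l) * s + l * t) ((1 - l) *\<^sub>R x + l *\<^sub>R y))"
      proof -
        have "replace_coord k ((1 - l) * s + l * t) ((1 - l) *\<^sub>R x + l *\<^sub>R y) = (1 - l) *\<^sub>R replace_coord k s x + l *\<^sub>R replace_coord k t y"
          by (simp add: vec_eq_iff)
        then have "f (replace_coord k s x) powr (1 - l) * f (replace_coord k t y) powr l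
          \<le> f (replace_coord k ((1 - l) * s + l * t) ((1 - l) *\<^sub>R x + l *\<^sub>R y))"
          using lc l by simp
        with std_normal_density_log_concave[OF l, of s t] show ?thesis
          by (simp add: powr_mult b) (smt (verit) mult_mono normal_density_nonneg powr_ge_zero mult_nonneg_nonneg mult.assoc mult.left_commute b)
      qed
    qed (use l b bd in auto)
  qed
qed

text \<open>
  Averaging over every coordinate but \<open>k\<close> preserves both integrals, as the slab depends on \<open>z\<^sub>k\<close>
  alone, and leaves an even log-concave function \<open>F\<close> of \<open>z\<^sub>k\<close>. Such a function decreases in
  \<open>\<bar>z\<^sub>k\<bar>\<close>, so it is at least \<open>F(r)\<close> inside the slab and at most \<open>F(r)\<close> outside; comparing the two
  parts of the integral with \<open>F(r)\<close> gives the correlation inequality.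
\<close>
theorem even_log_concave_slab_correlation:
  fixes f :: "real ^ 'n \<Rightarrow> real"
  assumes f: "even_log_concave f"
  shows "measure std_normal_vec {x :: real ^ 'n. \<bar>x $ k\<bar> \<le> r} * (\<integral>x. f x \<partial>std_normal_vec)
    \<le> (\<integral>x. indicator {x. \<bar>x $ k\<bar> \<le> r} x * f x \<partial>std_normal_vec)"
proof -
  define u :: "real ^ 'n \<Rightarrow> real" where "u = indicator {x. \<bar>x $ k\<bar> \<le> r}"
  have [measurable]: "{x :: real ^ 'n. \<bar>x $ k\<bar> \<le> r} \<in> sets borel"
    by (intro borel_closed closed_Collect_le continuous_intros)
  have um[measurable]: "u \<in> borel_measurable borel" unfolding u_def by measurable
  have u: "0 \<le> u x" "u x \<le> 1" for x by (auto simp: u_def)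
  have urep: "i \<noteq> k \<Longrightarrow> u (replace_coord i y x) = u x" for i y x
    by (auto simp: u_def indicator_def)
  have "\<exists>F. even_log_concave F \<and> (\<forall>i\<in>S. \<forall>x y. F (replace_coord i y x) = F x)
      \<and> (\<integral>x. F x \<partial>std_normal_vec) = (\<integral>x. f x \<partial>std_normal_vec)
      \<and> (\<integral>x. u x * F x \<partial>std_normal_vec) = (\<integral>x. u x * f x \<partial>std_normal_vec)"
    if "S \<subseteq> UNIV - {k}" for S
    using finite[of S] that
  proof (induction S)
    case empty
    then show ?case using f by auto
  next
    case (insert j S)
    then obtain F where F: "even_log_concave F" "\<And>i x y. i \<in> S \<Longrightarrow> F (replace_coord i y x) = F x"
      "(\<integral>x. F x \<partial>std_normal_vec) = (\<integral>x. f x \<partial>std_normal_vec)"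
      "(\<integral>x. u x * F x \<partial>std_normal_vec) = (\<integral>x. u x * f x \<partial>std_normal_vec)" by auto
    have Fm[measurable]: "F \<in> borel_measurable borel" and b: "0 \<le> F x" "F x \<le> 1" for x
      using F(1) by (auto simp: even_log_concave_def)
    define G where "G x = (\<integral>y. F (replace_coord j y x) \<partial>std_normal_distribution)" for x
    show ?case
    proof (intro exI[of _ G] conjI ballI allI)
      show "even_log_concave G" unfolding G_def by (rule even_log_concave_average[OF F(1)])
      fix i x y assume i: "i \<in> insert j S"
      have "F (replace_coord j t (replace_coord i y x)) = F (replace_coord j t x)" for t
      proof (cases "i = j")
        case True
        then have "replace_coord j t (replace_coord i y x) = replace_coord j t x" by (simp add: vec_eq_iff)
        then show ?thesis by simp
      next
        case False
        then have "replace_coord j t (replace_coord i y x) = replace_coord i y (replace_coord j t x)"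
          by (auto simp: vec_eq_iff)
        then show ?thesis using F(2) i False by auto
      qed
      then show "G (replace_coord i y x) = G x" by (simp add: G_def)
    next
      show "(\<integral>x. G x \<partial>std_normal_vec) = (\<integral>x. f x \<partial>std_normal_vec)"
        unfolding G_def F(3)[symmetric] by (rule integral_std_normal_vec_coord[symmetric, where c=1]) (auto simp: b)
      have "(\<integral>x. u x * F x \<partial>std_normal_vec) = (\<integral>x. (\<integral>y. u (replace_coord j y x) * F (replace_coord j y x) \<partial>std_normal_distribution) \<partial>std_normal_vec)"
        by (rule integral_std_normal_vec_coord[where c=1]) (auto simp: b u abs_mult intro: mult_le_one)
      also have "\<dots> = (\<integral>x. u x * G x \<partial>std_normal_vec)"
        using insert.prems by (simp add: urep G_def)
      finally show "(\<integral>x. u x * G x \<partial>std_normal_vec) = (\<integral>x. u x * f x \<partial>std_normal_vec)"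
        using F(4) by simp
    qed
  qed
  from this[OF order_refl] obtain F where F: "even_log_concave F"
    "\<And>i x y. i \<noteq> k \<Longrightarrow> F (replace_coord i y x) = F x"
    "(\<integral>x. F x \<partial>std_normal_vec) = (\<integral>x. f x \<partial>std_normal_vec)"
    "(\<integral>x. u x * F x \<partial>std_normal_vec) = (\<integral>x. u x * f x \<partial>std_normal_vec)" by auto
  have Fm[measurable]: "F \<in> borel_measurable borel" and b: "0 \<le> F x" "F x \<le> 1" and ev: "F (- x) = F x"
    and lc: "0 < l \<Longrightarrow> l < 1 \<Longrightarrow> F x powr (1 - l) * F y powr l \<le> F ((1 - l) *\<^sub>R x + l *\<^sub>R y)" for x y l
    using F(1) by (auto simp: even_log_concave_def)
  have dep: "F x = F y" if "x $ k = y $ k" for x y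
  proof -
    have "F (\<chi> i. if i \<in> S then y $ i else x $ i) = F x" if "S \<subseteq> UNIV - {k}" for S
      using finite[of S] that
    proof (induction S)
      case (insert j S)
      have "(\<chi> i. if i \<in> insert j S then y $ i else x $ i) = replace_coord j (y $ j) (\<chi> i. if i \<in> S then y $ i else x $ i)"
        by (auto simp: vec_eq_iff)
      then show ?case using insert F(2) by auto
    qed simp
    from this[OF order_refl] have "F (\<chi> i. if i \<in> UNIV - {k} then y $ i else x $ i) = F x" .
    moreover have "(\<chi> i. if i \<in> UNIV - {k} then y $ i else x $ i) = y" using that by (auto simp: vec_eq_iff)
    ultimately show ?thesis by simp
  qed
  have mono: "F w \<le> F z" if zw: "\<bar>z $ k\<bar> \<le> \<bar>w $ k\<bar>" for z w
  proof (cases "\<bar>z $ k\<bar> = \<bar>w $ k\<bar>")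
    case True
    then have "F z = F w \<or> F z = F (- w)" using dep[of z w] dep[of z "- w"] by (auto simp: abs_eq_iff)
    then show ?thesis by (auto simp: ev)
  next
    case False
    then have w: "\<bar>w $ k\<bar> > 0" "\<bar>z $ k\<bar> < \<bar>w $ k\<bar>" using zw by auto
    \<comment> \<open>the weight that writes \<open>z\<^sub>k\<close> as a convex combination of \<open>- w\<^sub>k\<close> and \<open>w\<^sub>k\<close>\<close>
    define l where "l = (1 + z $ k / w $ k) / 2"
    have "\<bar>z $ k / w $ k\<bar> < 1" using w by (simp add: abs_divide)
    then have "-1 < z $ k / w $ k" "z $ k / w $ k < 1" by linarith+
    then have l: "0 < l" "l < 1" unfolding l_def by auto
    have "z $ k = ((1 - l) *\<^sub>R (- w) + l *\<^sub>R w) $ k"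
      using w by (simp add: l_def field_simps)
    then have "F z = F ((1 - l) *\<^sub>R (- w) + l *\<^sub>R w)" by (rule dep)
    moreover have "F (- w) powr (1 - l) * F w powr l = F w"
      using b[of w] by (cases "F w = 0") (auto simp: ev powr_add[symmetric])
    ultimately show ?thesis using lc[OF l, of "- w" w] by simp
  qed
  define c where "c = F (\<chi> i. r)"
  define m where "m = measure std_normal_vec {x :: real ^ 'n. \<bar>x $ k\<bar> \<le> r}"
  have int: "integrable std_normal_vec g" if "g \<in> borel_measurable borel" "\<And>x. \<bar>g x\<bar> \<le> 1" for g :: "real ^ 'n \<Rightarrow> real"
    using that by (intro std_normal_vec.integrable_const_bound[where B=1]) auto
  have iu: "integrable std_normal_vec u" "integrable std_normal_vec F" "integrable std_normal_vec (\<lambda>x. u x * F x)"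
    by (auto intro!: int mult_le_one simp: u b abs_mult)
  have mu: "(\<integral>x. u x \<partial>std_normal_vec) = m" by (simp add: u_def m_def)
  have m01: "0 \<le> m" "m \<le> 1" by (auto simp: m_def)
  show ?thesis
  proof (cases "r < 0")
    case True
    then have "{x :: real ^ 'n. \<bar>x $ k\<bar> \<le> r} = {}" by auto
    then show ?thesis by simp
  next
    case False
    have in_c: "c * u x \<le> u x * F x" for x
      using False mono[of x "\<chi> i. r"] by (auto simp: u_def c_def indicator_def)
    have out_c: "F x - u x * F x \<le> c * (1 - u x)" for x
      using False mono[of "\<chi> i. r" x] by (auto simp: u_def c_def indicator_def)
    have "c * m \<le> (\<integral>x. u x * F x \<partial>std_normal_vec)"
      using integral_mono[of std_normal_vec "\<lambda>x. c * u x" "\<lambda>x. u x * F x"] iu in_c by (simp add: mu)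
    then have 1: "(1 - m) * (c * m) \<le> (1 - m) * (\<integral>x. u x * F x \<partial>std_normal_vec)"
      using m01 by (intro mult_left_mono) auto
    have "(\<integral>x. F x \<partial>std_normal_vec) - (\<integral>x. u x * F x \<partial>std_normal_vec) \<le> c * (1 - m)"
      using integral_mono[of std_normal_vec "\<lambda>x. F x - u x * F x" "\<lambda>x. c * (1 - u x)"] iu out_c
      by (simp add: mu std_normal_vec.prob_space[unfolded space_std_normal_vec])
    then have 2: "m * ((\<integral>x. F x \<partial>std_normal_vec) - (\<integral>x. u x * F x \<partial>std_normal_vec)) \<le> m * (c * (1 - m))"
      using m01 by (intro mult_left_mono) auto
    have "m * (\<integral>x. F x \<partial>std_normal_vec) \<le> (\<integral>x. u x * F x \<partial>std_normal_vec)"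
      using 1 2 by (simp add: algebra_simps)
    then show ?thesis using F by (simp add: m_def u_def)
  qed
qed

section \<open>Diagonalising a positive definite form\<close>
lemma symmetric_matrix_inner:
  fixes C :: "real ^ 'n ^ 'n"
  assumes "transpose C = C"
  shows "x \<bullet> (C *v y) = y \<bullet> (C *v x)"
  by (metis assms dot_lmul_matrix inner_commute transpose_matrix_vector)

text \<open>
  As long as the set has fewer elements than the dimension, its image under \<open>C\<close> does not span,
  and a nonzero vector orthogonal to that image is orthogonal to the set for the form \<open>x \<bullet> C y\<close>.
\<close>
lemma orthonormal_set_of_card:
  fixes C :: "real ^ 'n ^ 'n"
  assumes C: "positive_definite C" and v: "v \<bullet> (C *v v) = 1"
  shows "Suc m \<le> CARD('n) \<Longrightarrow> \<exists>S. finite S \<and> v \<in> S \<and> card S = Suc m \<and>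
    (\<forall>x\<in>S. \<forall>y\<in>S. x \<bullet> (C *v y) = (if x = y then 1 else 0))"
proof (induction m)
  case 0
  then show ?case using v by (intro exI[of _ "{v}"]) auto
next
  case (Suc m)
  then obtain S where S: "finite S" "v \<in> S" "card S = Suc m"
    "\<And>x y. x \<in> S \<Longrightarrow> y \<in> S \<Longrightarrow> x \<bullet> (C *v y) = (if x = y then 1 else 0)"
    by auto
  have "dim ((*v) C ` S) \<le> card ((*v) C ` S)"
    using S by (intro dim_le_card') auto
  also have "\<dots> \<le> card S" using S by (intro card_image_le)
  finally have "dim ((*v) C ` S) < CARD('n)"
    using Suc.prems S(3) by linarith
  moreover have "dim (UNIV :: (real ^ 'n) set) = CARD('n)" by simp
  ultimately have "span ((*v) C ` S) \<noteq> UNIV"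
    by (metis dim_span less_irrefl)
  then obtain a where a: "a \<noteq> 0" "\<And>x. x \<in> span ((*v) C ` S) \<Longrightarrow> a \<bullet> x = 0"
    using span_not_UNIV_orthogonal by blast
  define q where "q = a \<bullet> (C *v a)"
  have q: "q > 0" using C a by (auto simp: positive_definite_def q_def)
  define w where "w = (1 / sqrt q) *\<^sub>R a"
  have ww: "w \<bullet> (C *v w) = 1"
  proof -
    have "w \<bullet> (C *v w) = 1 / sqrt q * (1 / sqrt q) * q"
      unfolding w_def q_def by (simp only: matrix_vector_mult_scaleR inner_scaleR_left inner_scaleR_right mult.assoc)
    also have "\<dots> = 1" using q by (simp add: field_simps)
    finally show ?thesis .
  qed
  have ws: "w \<bullet> (C *v s) = 0" if "s \<in> S" for s
    using a(2)[of "C *v s"] that by (simp add: w_def span_base)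
  have sw: "s \<bullet> (C *v w) = 0" if "s \<in> S" for s
    using ws[OF that] symmetric_matrix_inner[of C s w] C by (simp add: positive_definite_def)
  have "w \<notin> S" using ws[of w] ww by auto
  then show ?case
    using S ww ws sw by (intro exI[of _ "insert w S"]) auto
qed

text \<open>
  Prescribing one column of \<open>V\<close> lets a chosen coordinate of \<open>X\<close> become, up to scaling, a
  coordinate of \<open>V\<^sup>T X\<close>.
\<close>
lemma positive_definite_diagonalise:
  fixes C :: "real ^ 'n ^ 'n"
  assumes C: "positive_definite C" and v: "v \<bullet> (C *v v) = 1"
  obtains V :: "real ^ 'n ^ 'n" and k where "transpose V ** C ** V = mat 1" "column k V = v"
proof -
  obtain m where m: "CARD('n) = Suc m" using gr0_conv_Suc[of "CARD('n)"] by (auto simp: card_gt_0_iff)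
  obtain S where S: "finite S" "v \<in> S" "card S = CARD('n)"
    "\<And>x y. x \<in> S \<Longrightarrow> y \<in> S \<Longrightarrow> x \<bullet> (C *v y) = (if x = y then 1 else 0)"
    using orthonormal_set_of_card[OF C v, of m] m by auto
  obtain b where b: "bij_betw b (UNIV :: 'n set) S"
    using S finite_same_card_bij[of "UNIV :: 'n set" S] by auto
  define V :: "real ^ 'n ^ 'n" where "V = (\<chi> i j. b j $ i)"
  have col: "column j V = b j" for j by (simp add: V_def column_def vec_eq_iff)
  have inj: "b i = b j \<longleftrightarrow> i = j" for i j using b by (auto simp: bij_betw_def inj_eq)
  have bS: "b j \<in> S" for j using b by (auto simp: bij_betw_def)
  have "(transpose V ** C ** V) $ i $ j = column i V \<bullet> (C *v column j V)" for i j
    unfolding matrix_mul_assoc[symmetric]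
    by (simp add: matrix_matrix_mult_def matrix_vector_mult_def transpose_def column_def inner_vec_def)
  then have "transpose V ** C ** V = mat 1"
    using S(4)[OF bS bS] inj by (intro iffD2[OF vec_eq_iff] allI) (simp add: col mat_def vec_lambda_beta)
  moreover obtain k where "b k = v" using b S(2) by (force simp: bij_betw_def)
  ultimately show thesis using that[of V k] col by auto
qed

section \<open>The law of a vector with standard normal linear forms\<close>

text \<open>
  This is the uniqueness theorem for characteristic functions, applied to the law of \<open>Y\<close> under the
  probability measure with density proportional to \<open>w\<close>.
\<close>
lemma (in prob_space) weighted_std_normal:
  fixes Y w :: "'a \<Rightarrow> real"
  assumes Y[measurable]: "Y \<in> borel_measurable M" and w[measurable]: "w \<in> borel_measurable M"
    and w0: "\<And>\<omega>. 0 \<le> w \<omega>" and int: "integrable M w"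
    and cf: "\<And>s. (CLINT \<omega>|M. w \<omega> * iexp (s * Y \<omega>)) = (\<integral>\<omega>. w \<omega> \<partial>M) * exp (- s\<^sup>2 / 2)"
    and B[measurable]: "B \<in> sets borel"
  shows "(\<integral>\<omega>. w \<omega> * indicator B (Y \<omega>) \<partial>M) = (\<integral>\<omega>. w \<omega> \<partial>M) * measure std_normal_distribution B"
proof (cases "(\<integral>\<omega>. w \<omega> \<partial>M) = 0")
  case True
  then have "AE \<omega> in M. w \<omega> = 0"
    using int w0 by (subst (asm) integral_nonneg_eq_0_iff_AE) auto
  then have "(\<integral>\<omega>. w \<omega> * indicator B (Y \<omega>) \<partial>M) = (\<integral>\<omega>. 0 \<partial>M)"
    by (intro integral_cong_AE) auto
  then show ?thesis using True by simp
next
  case False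
  define c where "c = (\<integral>\<omega>. w \<omega> \<partial>M)"
  have c: "c > 0" using False w0 by (simp add: c_def less_le integral_nonneg)
  define M' where "M' = density M (\<lambda>\<omega>. ennreal (w \<omega> / c))"
  have M': "prob_space M'"
  proof
    have "emeasure M' (space M') = (\<integral>\<^sup>+\<omega>. ennreal (w \<omega> / c) \<partial>M)"
      by (simp add: M'_def emeasure_density cong: nn_integral_cong)
    also have "\<dots> = ennreal (\<integral>\<omega>. w \<omega> / c \<partial>M)"
      using int w0 c by (intro nn_integral_eq_integral) auto
    also have "(\<integral>\<omega>. w \<omega> / c \<partial>M) = 1" using c by (simp add: c_def)
    finally show "emeasure M' (space M') = 1" by simp
  qed
  interpret M': prob_space M' by (rule M')
  have Y': "Y \<in> borel_measurable M'" by (simp add: M'_def)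
  have "distr M' borel Y = std_normal_distribution"
  proof (rule Levy_uniqueness)
    show "real_distribution (distr M' borel Y)" using Y' by simp
    show "real_distribution std_normal_distribution" by (rule real_dist_normal_dist)
    have "char (distr M' borel Y) s = char std_normal_distribution s" for s
    proof -
      have "char (distr M' borel Y) s = (CLINT \<omega>|M'. iexp (s * Y \<omega>))"
        unfolding char_def using Y' by (simp add: integral_distr)
      also have "\<dots> = (CLINT \<omega>|M. (w \<omega> / c) *\<^sub>R iexp (s * Y \<omega>))"
        unfolding M'_def using w0 c by (subst integral_density) auto
      also have "\<dots> = (CLINT \<omega>|M. (1 / c) *\<^sub>R (w \<omega> * iexp (s * Y \<omega>)))"
        by (simp add: scaleR_conv_of_real)
      also have "\<dots> = (1 / c) *\<^sub>R (CLINT \<omega>|M. w \<omega> * iexp (s * Y \<omega>))"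
        by (rule integral_scaleR_right) 
      also have "\<dots> = exp (- s\<^sup>2 / 2)" 
        using c unfolding cf c_def[symmetric] by (simp add: scaleR_conv_of_real)
      finally show ?thesis by (simp add: char_std_normal_distribution exp_of_real)
    qed
    then show "char (distr M' borel Y) = char std_normal_distribution" by auto
  qed
  then have "measure std_normal_distribution B = measure (distr M' borel Y) B" by simp
  also have "\<dots> = (\<integral>\<omega>. indicator B (Y \<omega>) \<partial>M')"
    using Y' by (subst integral_distr[symmetric, of Y M' borel]) auto
  also have "\<dots> = (\<integral>\<omega>. (w \<omega> / c) *\<^sub>R indicator B (Y \<omega>) \<partial>M)"
    unfolding M'_def using w0 c by (subst integral_density) auto
  also have "\<dots> = (\<integral>\<omega>. w \<omega> * indicator B (Y \<omega>) \<partial>M) / c" by simp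
  finally show ?thesis using c by (simp add: c_def field_simps)
qed

lemma iexp_cos_shift:
  "complex_of_real (1 + cos (x + \<theta>)) = 1 + (iexp \<theta> / 2) * iexp x + (iexp (- \<theta>) / 2) * iexp (- x)"
proof -
  have "complex_of_real (cos y) = (iexp y + iexp (- y)) / 2" for y
    by (simp add: cos_of_real[symmetric] cos_exp_eq)
  note this[of "x + \<theta>"]
  also have "iexp (x + \<theta>) = iexp \<theta> * iexp x"
    by (simp add: exp_add[symmetric] algebra_simps)
  also have "iexp (- (x + \<theta>)) = iexp (- \<theta>) * iexp (- x)"
    unfolding exp_add[symmetric] by (rule arg_cong[where f=exp]) (simp add: algebra_simps)
  finally show ?thesis by (simp add: field_simps)
qed

text \<open>
  The coordinates in \<open>I\<close> are turned one by one from frequencies into events. Let \<open>W\<close> be the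
  indicator of the events already treated and \<open>j\<close> a new coordinate. The factor \<open>iexp (t \<bullet> Z)\<close> is not
  a positive weight, but \<open>W * (1 + cos (t \<bullet> Z + \<theta>))\<close> is, and since the cosine is a combination of
  \<open>iexp (t \<bullet> Z)\<close> and \<open>iexp (- (t \<bullet> Z))\<close>, the induction hypothesis gives the characteristic function
  of \<open>Z\<^sub>j\<close> under it. The phases \<open>0\<close> and \<open>- pi / 2\<close> recover the real and the imaginary part.
\<close>
lemma (in prob_space) std_normal_vec_marginals:
  fixes Z :: "'a \<Rightarrow> real ^ 'n"
  assumes Z[measurable]: "Z \<in> borel_measurable M"
    and cf: "\<And>t. (CLINT \<omega>|M. iexp (t \<bullet> Z \<omega>)) = exp (- (norm t)\<^sup>2 / 2)"
    and B: "\<And>i. B i \<in> sets borel"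
  shows "\<And>t. (\<And>i. i \<in> I \<Longrightarrow> t $ i = 0) \<Longrightarrow>
    (CLINT \<omega>|M. (\<Prod>i\<in>I. indicator (B i) (Z \<omega> $ i) :: real) * iexp (t \<bullet> Z \<omega>))
      = (\<Prod>i\<in>I. measure std_normal_distribution (B i)) * exp (- (norm t)\<^sup>2 / 2)"
  using finite[of I]
proof (induction I)
  case empty
  then show ?case by (simp add: cf)
next
  case (insert j I)
  note [measurable] = B
  have [measurable]: "(\<lambda>\<omega>. Z \<omega> $ i) \<in> borel_measurable M" for i
    using measurable_compose[OF Z borel_measurable_nth] by simp
  define W where "W \<omega> = (\<Prod>i\<in>I. indicator (B i) (Z \<omega> $ i) :: real)" for \<omega>
  define m where "m = (\<Prod>i\<in>I. measure std_normal_distribution (B i))"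
  have W[measurable]: "W \<in> borel_measurable M" unfolding W_def[abs_def] by measurable
  have W01: "0 \<le> W \<omega>" "W \<omega> \<le> 1" for \<omega>
    by (auto simp: W_def intro!: prod_nonneg prod_le_1)
  have IH: "(CLINT \<omega>|M. W \<omega> * iexp (t \<bullet> Z \<omega>)) = m * exp (- (norm t)\<^sup>2 / 2)" if "\<And>i. i \<in> I \<Longrightarrow> t $ i = 0" for t
    unfolding W_def m_def using insert.IH[OF that] by simp
  have intW: "integrable M (\<lambda>\<omega>. W \<omega> * iexp (g \<omega>))" if [measurable]: "g \<in> borel_measurable M" for g
    by (rule integrable_const_bound[where B=1]) (auto simp: norm_mult W01)
  have t0: "t $ j = 0" and tI: "\<And>i. i \<in> I \<Longrightarrow> t $ i = 0" using insert.prems by auto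
  let ?e = "axis j 1 :: real ^ 'n"
  have nrm: "(norm (s *\<^sub>R ?e + t))\<^sup>2 = s\<^sup>2 + (norm t)\<^sup>2" "(norm (s *\<^sub>R ?e - t))\<^sup>2 = s\<^sup>2 + (norm t)\<^sup>2" for s
    unfolding power2_norm_eq_inner using t0
    by (simp_all add: inner_add_left inner_add_right inner_diff_left inner_diff_right inner_axis inner_axis' power2_eq_square)
  have eI: "i \<in> I \<Longrightarrow> ?e $ i = 0" for i using insert.hyps by (auto simp: axis_def)
  define E where "E = exp (- (norm t)\<^sup>2 / 2)"
  have phase: "(\<integral>\<omega>. W \<omega> * (1 + cos (t \<bullet> Z \<omega> + \<theta>)) * indicator (B j) (Z \<omega> $ j) \<partial>M)
    = m * (1 + cos \<theta> * E) * measure std_normal_distribution (B j)" for \<theta>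
  proof -
    define w where "w \<omega> = W \<omega> * (1 + cos (t \<bullet> Z \<omega> + \<theta>))" for \<omega>
    have w[measurable]: "w \<in> borel_measurable M" unfolding w_def[abs_def] by measurable
    have c0: "0 \<le> 1 + cos (t \<bullet> Z \<omega> + \<theta>)" for \<omega>
      using cos_ge_minus_one[of "t \<bullet> Z \<omega> + \<theta>"] by linarith
    have w0: "0 \<le> w \<omega>" for \<omega> using W01 c0 by (simp add: w_def)
    have iw: "integrable M w"
    proof (rule integrable_const_bound[where B=2])
      have "W \<omega> * (1 + cos (t \<bullet> Z \<omega> + \<theta>)) \<le> 1 * 2" for \<omega>
        using W01 c0 by (intro mult_mono) auto
      then show "AE \<omega> in M. norm (w \<omega>) \<le> 2" using w0 by (auto simp: w_def[symmetric])
    qed simp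
    have cw: "(CLINT \<omega>|M. w \<omega> * iexp (s * Z \<omega> $ j)) = complex_of_real (m * (1 + cos \<theta> * E) * exp (- s\<^sup>2 / 2))" for s
    proof -
      have "(CLINT \<omega>|M. w \<omega> * iexp (s * Z \<omega> $ j))
        = (CLINT \<omega>|M. W \<omega> * iexp ((s *\<^sub>R ?e) \<bullet> Z \<omega>) + (iexp \<theta> / 2) * (W \<omega> * iexp ((s *\<^sub>R ?e + t) \<bullet> Z \<omega>))
          + (iexp (- \<theta>) / 2) * (W \<omega> * iexp ((s *\<^sub>R ?e - t) \<bullet> Z \<omega>)))"
      proof (rule Bochner_Integration.integral_cong[OF refl])
        fix \<omega>
        have e: "?e \<bullet> Z \<omega> = Z \<omega> $ j" by (simp add: inner_axis')
        have "iexp ((s *\<^sub>R ?e + t) \<bullet> Z \<omega>) = iexp (s * Z \<omega> $ j) * iexp (t \<bullet> Z \<omega>)"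
          "iexp ((s *\<^sub>R ?e - t) \<bullet> Z \<omega>) = iexp (s * Z \<omega> $ j) * iexp (- (t \<bullet> Z \<omega>))"
          "iexp ((s *\<^sub>R ?e) \<bullet> Z \<omega>) = iexp (s * Z \<omega> $ j)"
          by (simp_all add: e inner_add_left inner_diff_left exp_add[symmetric] ring_distribs)
        then show "w \<omega> * iexp (s * Z \<omega> $ j) = W \<omega> * iexp ((s *\<^sub>R ?e) \<bullet> Z \<omega>) + (iexp \<theta> / 2) * (W \<omega> * iexp ((s *\<^sub>R ?e + t) \<bullet> Z \<omega>))
          + (iexp (- \<theta>) / 2) * (W \<omega> * iexp ((s *\<^sub>R ?e - t) \<bullet> Z \<omega>))"
          unfolding w_def of_real_mult iexp_cos_shift by (simp only: ring_distribs mult_1_left mult_1_right ac_simps)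
      qed
      also have "\<dots> = (CLINT \<omega>|M. W \<omega> * iexp ((s *\<^sub>R ?e) \<bullet> Z \<omega>)) + (iexp \<theta> / 2) * (CLINT \<omega>|M. W \<omega> * iexp ((s *\<^sub>R ?e + t) \<bullet> Z \<omega>))
          + (iexp (- \<theta>) / 2) * (CLINT \<omega>|M. W \<omega> * iexp ((s *\<^sub>R ?e - t) \<bullet> Z \<omega>))"
        by (simp add: intW del: of_real_mult of_real_prod)
      also have "\<dots> = m * exp (- s\<^sup>2 / 2) + (iexp \<theta> / 2) * (m * (exp (- s\<^sup>2 / 2) * E)) + (iexp (- \<theta>) / 2) * (m * (exp (- s\<^sup>2 / 2) * E))"
      proof -
        have "exp (- (s\<^sup>2 + (norm t)\<^sup>2) / 2) = exp (- s\<^sup>2 / 2) * E"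
          by (simp add: E_def exp_add[symmetric] add_divide_distrib)
        moreover have "norm (s *\<^sub>R ?e) ^ 2 = s\<^sup>2" by simp
        ultimately show ?thesis
          by (subst IH, simp add: eI, subst IH, simp add: eI tI, subst IH, simp add: eI tI) (simp only: nrm of_real_mult)
      qed
      also have "\<dots> = m * exp (- s\<^sup>2 / 2) * (1 + (iexp \<theta> + iexp (- \<theta>)) / 2 * E)"
        by (simp add: field_simps)
      also have "(iexp \<theta> + iexp (- \<theta>)) / 2 = cos \<theta>"
        by (simp add: cos_of_real[symmetric] cos_exp_eq)
      finally show ?thesis by (simp add: field_simps)
    qed
    have tot: "(\<integral>\<omega>. w \<omega> \<partial>M) = m * (1 + cos \<theta> * E)"
    proof -
      have "complex_of_real (\<integral>\<omega>. w \<omega> \<partial>M) = complex_of_real (m * (1 + cos \<theta> * E))"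
        using cw[of 0] by simp
      then show ?thesis by (simp only: of_real_eq_iff)
    qed
    have "(\<integral>\<omega>. w \<omega> * indicator (B j) (Z \<omega> $ j) \<partial>M) = (\<integral>\<omega>. w \<omega> \<partial>M) * measure std_normal_distribution (B j)"
      by (rule weighted_std_normal) (use w0 iw cw tot B in simp_all)
    then show ?thesis unfolding tot by (simp add: w_def)
  qed
  define q where "q = measure std_normal_distribution (B j)"
  define W' where "W' \<omega> = W \<omega> * indicator (B j) (Z \<omega> $ j)" for \<omega>
  have W'[measurable]: "W' \<in> borel_measurable M" unfolding W'_def[abs_def] by measurable
  have W'01: "\<bar>W' \<omega>\<bar> \<le> 1" for \<omega> using W01[of \<omega>] by (auto simp: W'_def indicator_def)
  have intW': "integrable M (\<lambda>\<omega>. W' \<omega> * cos (t \<bullet> Z \<omega> + \<theta>))" "integrable M W'" for \<theta>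
    by (rule integrable_const_bound[where B=1]; force simp: abs_mult W'01 intro!: mult_le_one)+
  have phase': "(\<integral>\<omega>. W' \<omega> \<partial>M) + (\<integral>\<omega>. W' \<omega> * cos (t \<bullet> Z \<omega> + \<theta>) \<partial>M) = m * q + m * q * E * cos \<theta>" for \<theta>
  proof -
    have "(\<integral>\<omega>. W' \<omega> \<partial>M) + (\<integral>\<omega>. W' \<omega> * cos (t \<bullet> Z \<omega> + \<theta>) \<partial>M)
      = (\<integral>\<omega>. W' \<omega> + W' \<omega> * cos (t \<bullet> Z \<omega> + \<theta>) \<partial>M)"
      by (simp add: intW')
    also have "\<dots> = (\<integral>\<omega>. W \<omega> * (1 + cos (t \<bullet> Z \<omega> + \<theta>)) * indicator (B j) (Z \<omega> $ j) \<partial>M)"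
      by (rule Bochner_Integration.integral_cong) (auto simp: W'_def algebra_simps)
    also have "\<dots> = m * (1 + cos \<theta> * E) * q" by (simp only: phase q_def)
    also have "\<dots> = m * q + m * q * E * cos \<theta>" by (simp add: algebra_simps)
    finally show ?thesis .
  qed
  \<comment> \<open>opposite phases cancel the cosine and isolate the integral of the event alone\<close>
  have opp: "(\<integral>\<omega>. W' \<omega> * cos (t \<bullet> Z \<omega> + pi) \<partial>M) = - (\<integral>\<omega>. W' \<omega> * cos (t \<bullet> Z \<omega> + 0) \<partial>M)"
    by simp
  have tot': "(\<integral>\<omega>. W' \<omega> \<partial>M) = m * q"
    using phase'[of 0] phase'[of pi] opp by simp
  have ph: "(\<integral>\<omega>. W' \<omega> * cos (t \<bullet> Z \<omega> + \<theta>) \<partial>M) = m * q * E * cos \<theta>" for \<theta>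
    using phase'[of \<theta>] tot' by simp
  have quarter: "cos (y - pi / 2) = sin y" for y
    by (simp add: cos_diff)
  have "(CLINT \<omega>|M. W' \<omega> * iexp (t \<bullet> Z \<omega>)) = (CLINT \<omega>|M. complex_of_real (W' \<omega> * cos (t \<bullet> Z \<omega> + 0)) + \<i> * complex_of_real (W' \<omega> * cos (t \<bullet> Z \<omega> + (- pi / 2))))"
    by (intro Bochner_Integration.integral_cong)
       (auto simp: exp_Euler cos_of_real sin_of_real quarter algebra_simps)
  also have "\<dots> = complex_of_real (\<integral>\<omega>. W' \<omega> * cos (t \<bullet> Z \<omega> + 0) \<partial>M) + \<i> * complex_of_real (\<integral>\<omega>. W' \<omega> * cos (t \<bullet> Z \<omega> + (- pi / 2)) \<partial>M)"
    using intW'(1)[of 0] intW'(1)[of "- pi / 2"]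
    by (subst Bochner_Integration.integral_add) (auto simp del: of_real_mult)
  also have "\<dots> = m * q * E"
    by (simp only: ph) simp
  finally show ?case
    using insert.hyps by (simp add: W'_def W_def m_def q_def E_def ac_simps)
qed

theorem (in prob_space) distr_eq_std_normal_vec:
  fixes Z :: "'a \<Rightarrow> real ^ 'n"
  assumes Z[measurable]: "Z \<in> borel_measurable M"
    and cf: "\<And>t. (CLINT \<omega>|M. iexp (t \<bullet> Z \<omega>)) = exp (- (norm t)\<^sup>2 / 2)"
  shows "distr M borel Z = std_normal_vec"
proof -
  have nth[measurable]: "(\<lambda>\<omega>. Z \<omega> $ i) \<in> borel_measurable M" for i
    using measurable_compose[OF Z borel_measurable_nth] by simp
  have meas: "(\<lambda>\<omega> i. Z \<omega> $ i) \<in> M \<rightarrow>\<^sub>M PiM UNIV (\<lambda>_. std_normal_distribution)"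
    using measurable_PiM_single'[of UNIV "\<lambda>i \<omega>. Z \<omega> $ i" M "\<lambda>_. std_normal_distribution"] by simp
  have "distr M (PiM UNIV (\<lambda>_. std_normal_distribution)) (\<lambda>\<omega> i. Z \<omega> $ i) = PiM UNIV (\<lambda>_. std_normal_distribution)"
  proof (rule std_normal_product.PiM_eqI)
    fix B :: "'n \<Rightarrow> real set" assume "\<And>i. i \<in> UNIV \<Longrightarrow> B i \<in> sets std_normal_distribution"
    then have B[measurable]: "B i \<in> sets borel" for i by simp
    have BP: "PiE UNIV B \<in> sets (PiM UNIV (\<lambda>_. std_normal_distribution))" by (intro sets_PiM_I_finite) auto
    have "emeasure (distr M (PiM UNIV (\<lambda>_. std_normal_distribution)) (\<lambda>\<omega> i. Z \<omega> $ i)) (PiE UNIV B) = emeasure M {\<omega> \<in> space M. \<forall>i. Z \<omega> $ i \<in> B i}"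
      by (subst emeasure_distr[OF meas BP]) (auto simp: PiE_iff intro!: arg_cong2[where f=emeasure])
    also have "\<dots> = ennreal (measure M {\<omega> \<in> space M. \<forall>i. Z \<omega> $ i \<in> B i})"
      by (rule emeasure_eq_measure)
    also have "measure M {\<omega> \<in> space M. \<forall>i. Z \<omega> $ i \<in> B i} = (\<Prod>i\<in>UNIV. measure std_normal_distribution (B i))"
    proof -
      have "(\<integral>\<omega>. (\<Prod>i\<in>UNIV. indicator (B i) (Z \<omega> $ i) :: real) \<partial>M) = (\<Prod>i\<in>UNIV. measure std_normal_distribution (B i))"
      proof -
        have "complex_of_real (\<integral>\<omega>. (\<Prod>i\<in>UNIV. indicator (B i) (Z \<omega> $ i) :: real) \<partial>M)
          = complex_of_real (\<Prod>i\<in>UNIV. measure std_normal_distribution (B i))"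
          using std_normal_vec_marginals[OF Z cf B, of UNIV 0]
          by (simp add: integral_complex_of_real[symmetric] del: of_real_prod integral_complex_of_real)
        then show ?thesis by (simp only: of_real_eq_iff)
      qed
      moreover have "(\<integral>\<omega>. (\<Prod>i\<in>UNIV. indicator (B i) (Z \<omega> $ i) :: real) \<partial>M)
        = (\<integral>\<omega>. indicator {\<omega> \<in> space M. \<forall>i. Z \<omega> $ i \<in> B i} \<omega> \<partial>M)"
        by (intro Bochner_Integration.integral_cong) (auto simp: indicator_def prod_zero_iff)
      ultimately show ?thesis by simp
    qed
    also have "ennreal \<dots> = (\<Prod>i\<in>UNIV. emeasure std_normal_distribution (B i))"
      by (simp add: prod_ennreal[symmetric] std_normal.emeasure_eq_measure)
    finally show "emeasure (distr M (PiM UNIV (\<lambda>_. std_normal_distribution)) (\<lambda>\<omega> i. Z \<omega> $ i)) (PiE UNIV B) = (\<Prod>i\<in>UNIV. emeasure std_normal_distribution (B i))" .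
  qed auto
  then have "std_normal_vec = distr (distr M (PiM UNIV (\<lambda>_. std_normal_distribution)) (\<lambda>\<omega> i. Z \<omega> $ i)) borel (vec_lambda :: _ \<Rightarrow> real ^ 'n)"
    by (simp add: std_normal_vec_def)
  also have "\<dots> = distr M borel Z"
    by (subst distr_distr[OF measurable_vec_std meas]) (simp add: comp_def vec_nth_inverse)
  finally show ?thesis by simp
qed

section \<open>Whitening a Gaussian vector\<close>
lemma (in prob_space) gaussian_law_moments:
  fixes Y :: "'a \<Rightarrow> real"
  assumes Y[measurable]: "Y \<in> borel_measurable M" and law: "distr M borel Y = gaussian_law \<mu> \<sigma>" and \<sigma>: "0 \<le> \<sigma>"
  shows "integrable M Y" "integrable M (\<lambda>\<omega>. (Y \<omega>)\<^sup>2)" "(\<integral>\<omega>. Y \<omega> \<partial>M) = \<mu>"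
    "(\<integral>\<omega>. (Y \<omega>)\<^sup>2 \<partial>M) = \<sigma>\<^sup>2 + \<mu>\<^sup>2"
proof -
  have "integrable M Y \<and> integrable M (\<lambda>\<omega>. (Y \<omega>)\<^sup>2) \<and> (\<integral>\<omega>. Y \<omega> \<partial>M) = \<mu> \<and> (\<integral>\<omega>. (Y \<omega>)\<^sup>2 \<partial>M) = \<sigma>\<^sup>2 + \<mu>\<^sup>2"
  proof (cases "\<sigma> = 0")
    case True
    have "AE y in distr M borel Y. y = \<mu>"
      unfolding law gaussian_law_def using True by (simp add: AE_return)
    then have ae: "AE \<omega> in M. Y \<omega> = \<mu>" by (subst (asm) AE_distr_iff) auto
    have "integrable M Y"
      using ae by (auto intro!: integrable_const_bound[where B="\<bar>\<mu>\<bar>"])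
    moreover have "integrable M (\<lambda>\<omega>. (Y \<omega>)\<^sup>2)"
      using ae by (auto intro!: integrable_const_bound[where B="\<mu>\<^sup>2"])
    moreover have "(\<integral>\<omega>. Y \<omega> \<partial>M) = (\<integral>\<omega>. \<mu> \<partial>M)"
      by (rule integral_cong_AE) (use ae in auto)
    moreover have "(\<integral>\<omega>. (Y \<omega>)\<^sup>2 \<partial>M) = (\<integral>\<omega>. \<mu>\<^sup>2 \<partial>M)"
      by (rule integral_cong_AE) (use ae in auto)
    ultimately show ?thesis using True by (simp add: prob_space)
  next
    case False
    then have s: "\<sigma> > 0" using \<sigma> by simp
    let ?n = "normal_density \<mu> \<sigma>"
    have D: "distributed M lborel Y (\<lambda>x. ennreal (?n x))"
      using law False by (auto simp: distributed_def gaussian_law_def cong: distr_cong)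
    have 1: "has_bochner_integral lborel (\<lambda>x. ?n x * x) \<mu>"
      by (rule normal_moment_nz_1[OF s])
    have "has_bochner_integral lborel (\<lambda>x. ?n x * (x - \<mu>)\<^sup>2) (\<sigma>\<^sup>2)"
      using normal_moment_even[OF s, of \<mu> 1] s by (simp add: fact_2)
    moreover have "has_bochner_integral lborel (\<lambda>x. 2 * \<mu> * (?n x * x)) (2 * \<mu> * \<mu>)"
      by (rule has_bochner_integral_mult_right) (rule 1)
    moreover have "has_bochner_integral lborel (\<lambda>x. \<mu>\<^sup>2 * ?n x) (\<mu>\<^sup>2 * 1)"
      using s by (intro has_bochner_integral_mult_right) (simp add: has_bochner_integral_iff)
    ultimately have "has_bochner_integral lborel (\<lambda>x. ?n x * (x - \<mu>)\<^sup>2 + 2 * \<mu> * (?n x * x) - \<mu>\<^sup>2 * ?n x) (\<sigma>\<^sup>2 + 2 * \<mu> * \<mu> - \<mu>\<^sup>2 * 1)"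
      by (intro has_bochner_integral_add has_bochner_integral_diff)
    then have 2: "has_bochner_integral lborel (\<lambda>x. ?n x * x\<^sup>2) (\<sigma>\<^sup>2 + \<mu>\<^sup>2)"
      by (simp add: power2_eq_square algebra_simps)
    show ?thesis
      using distributed_integrable[OF D, of "\<lambda>x. x"] distributed_integral[OF D, of "\<lambda>x. x"]
        distributed_integrable[OF D, of "\<lambda>x. x\<^sup>2"] distributed_integral[OF D, of "\<lambda>x. x\<^sup>2"] 1 2
      by (simp add: has_bochner_integral_iff)
  qed
  then show "integrable M Y" "integrable M (\<lambda>\<omega>. (Y \<omega>)\<^sup>2)" "(\<integral>\<omega>. Y \<omega> \<partial>M) = \<mu>"
    "(\<integral>\<omega>. (Y \<omega>)\<^sup>2 \<partial>M) = \<sigma>\<^sup>2 + \<mu>\<^sup>2" by auto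
qed

lemma char_gaussian_law:
  assumes "0 \<le> \<sigma>"
  shows "char (gaussian_law 0 \<sigma>) t = exp (- (\<sigma> * t)\<^sup>2 / 2)"
proof (cases "\<sigma> = 0")
  case True
  then show ?thesis by (simp add: gaussian_law_def char_def integral_return)
next
  case False
  then have s: "\<sigma> > 0" using assms by simp
  have eq: "normal_density 0 \<sigma> (\<sigma> * x) = std_normal_density x / \<sigma>" for x
    using s by (simp add: normal_density_def power_mult_distrib real_sqrt_mult)
  have "char (gaussian_law 0 \<sigma>) t = (CLINT x|lborel. normal_density 0 \<sigma> x *\<^sub>R iexp (t * x))"
    using False by (simp add: gaussian_law_def char_def integral_density)
  also have "\<dots> = \<bar>\<sigma>\<bar> *\<^sub>R (CLINT x|lborel. normal_density 0 \<sigma> (0 + \<sigma> * x) *\<^sub>R iexp (t * (0 + \<sigma> * x)))"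
    by (rule lborel_integral_real_affine) (use False in simp)
  also have "\<dots> = (CLINT x|lborel. std_normal_density x *\<^sub>R iexp ((\<sigma> * t) * x))"
  proof -
    have "normal_density 0 \<sigma> (0 + \<sigma> * x) *\<^sub>R iexp (t * (0 + \<sigma> * x)) = (1 / \<sigma>) *\<^sub>R (std_normal_density x *\<^sub>R iexp ((\<sigma> * t) * x))" for x
      by (simp add: eq ac_simps)
    then have "\<bar>\<sigma>\<bar> *\<^sub>R (CLINT x|lborel. normal_density 0 \<sigma> (0 + \<sigma> * x) *\<^sub>R iexp (t * (0 + \<sigma> * x)))
      = \<bar>\<sigma>\<bar> *\<^sub>R (1 / \<sigma>) *\<^sub>R (CLINT x|lborel. std_normal_density x *\<^sub>R iexp ((\<sigma> * t) * x))"
      by (simp only: integral_scaleR_right)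
    then show ?thesis using s by simp
  qed
  also have "\<dots> = char std_normal_distribution (\<sigma> * t)"
    by (simp add: char_def integral_density)
  finally show ?thesis by (simp add: char_std_normal_distribution)
qed

text \<open>
  The law of a linear form is Gaussian with unspecified parameters; the vanishing means of the
  coordinates and the covariance matrix determine them. The linear forms given by the coordinates
  themselves supply the integrability of all second moments.
\<close>
lemma centered_gaussian_linear_form:
  fixes X :: "'a \<Rightarrow> real ^ 'n"
  assumes X: "centered_gaussian_vector M X"
  obtains \<sigma> where "0 \<le> \<sigma>" "distr M borel (\<lambda>\<omega>. a \<bullet> X \<omega>) = gaussian_law 0 \<sigma>"
    "\<sigma>\<^sup>2 = a \<bullet> (covariance_matrix M X *v a)"
proof -
  interpret prob_space M using X by (simp add: centered_gaussian_vector_def gaussian_vector_def)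
  have Xm[measurable]: "X \<in> borel_measurable M" and mean: "\<And>i. (\<integral>\<omega>. X \<omega> $ i \<partial>M) = 0"
    and law: "\<And>a. \<exists>\<mu> \<sigma>. 0 \<le> \<sigma> \<and> distr M borel (\<lambda>\<omega>. a \<bullet> X \<omega>) = gaussian_law \<mu> \<sigma>"
    using X by (auto simp: centered_gaussian_vector_def gaussian_vector_def)
  have ax: "axis i 1 \<bullet> X \<omega> = X \<omega> $ i" for i \<omega> by (simp add: inner_axis')
  have nth[measurable]: "(\<lambda>\<omega>. X \<omega> $ i) \<in> borel_measurable M" for i
    using measurable_compose[OF Xm borel_measurable_nth] by simp
  have int: "integrable M (\<lambda>\<omega>. X \<omega> $ i)" "integrable M (\<lambda>\<omega>. (X \<omega> $ i)\<^sup>2)" for i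
    using law[of "axis i 1"] gaussian_law_moments(1,2)[of "\<lambda>\<omega>. X \<omega> $ i"] by (auto simp: ax)
  have int2: "integrable M (\<lambda>\<omega>. X \<omega> $ i * X \<omega> $ j)" for i j
  proof (rule Bochner_Integration.integrable_bound)
    show "integrable M (\<lambda>\<omega>. (X \<omega> $ i)\<^sup>2 + (X \<omega> $ j)\<^sup>2)" using int by auto
    have "\<bar>x * y\<bar> \<le> x\<^sup>2 + y\<^sup>2" for x y :: real
    proof -
      have "2 * (\<bar>x\<bar> * \<bar>y\<bar>) \<le> x\<^sup>2 + y\<^sup>2"
        using sum_squares_bound[of "\<bar>x\<bar>" "\<bar>y\<bar>"] by simp
      moreover have "0 \<le> \<bar>x\<bar> * \<bar>y\<bar>" by simp
      ultimately show ?thesis unfolding abs_mult by linarith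
    qed
    then show "AE \<omega> in M. norm (X \<omega> $ i * X \<omega> $ j) \<le> norm ((X \<omega> $ i)\<^sup>2 + (X \<omega> $ j)\<^sup>2)" by simp
  qed simp
  have E: "a \<bullet> X \<omega> = (\<Sum>i\<in>UNIV. a $ i * X \<omega> $ i)" for \<omega> by (simp add: inner_vec_def)
  have m1: "(\<integral>\<omega>. a \<bullet> X \<omega> \<partial>M) = 0"
    unfolding E using int mean by simp
  have m2: "(\<integral>\<omega>. (a \<bullet> X \<omega>)\<^sup>2 \<partial>M) = a \<bullet> (covariance_matrix M X *v a)"
  proof -
    have "(\<integral>\<omega>. (a \<bullet> X \<omega>)\<^sup>2 \<partial>M) = (\<integral>\<omega>. (\<Sum>i\<in>UNIV. \<Sum>j\<in>UNIV. a $ i * a $ j * (X \<omega> $ i * X \<omega> $ j)) \<partial>M)"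
      unfolding E power2_eq_square sum_product by (simp add: ac_simps)
    also have "\<dots> = (\<Sum>i\<in>UNIV. \<Sum>j\<in>UNIV. a $ i * a $ j * (\<integral>\<omega>. X \<omega> $ i * X \<omega> $ j \<partial>M))"
      using int2 by simp
    also have "\<dots> = a \<bullet> (covariance_matrix M X *v a)"
      by (simp add: inner_vec_def matrix_vector_mult_def covariance_matrix_def sum_distrib_left ac_simps)
    finally show ?thesis .
  qed
  obtain \<mu> \<sigma> where s: "0 \<le> \<sigma>" "distr M borel (\<lambda>\<omega>. a \<bullet> X \<omega>) = gaussian_law \<mu> \<sigma>" using law by blast
  have mu: "\<mu> = 0" using gaussian_law_moments(3)[OF _ s(2,1)] m1 by simp
  then have "\<sigma>\<^sup>2 = a \<bullet> (covariance_matrix M X *v a)"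
    using gaussian_law_moments(4)[OF _ s(2,1)] m2 by simp
  then show thesis using that s mu by simp
qed

theorem gaussian_whitening:
  fixes X :: "'a \<Rightarrow> real ^ 'n" and V :: "real ^ 'n ^ 'n"
  assumes X: "centered_gaussian_vector M X"
    and V: "transpose V ** covariance_matrix M X ** V = mat 1"
  shows "distr M borel (\<lambda>\<omega>. transpose V *v X \<omega>) = std_normal_vec"
proof -
  interpret prob_space M using X by (simp add: centered_gaussian_vector_def gaussian_vector_def)
  have Xm[measurable]: "X \<in> borel_measurable M"
    using X by (auto simp: centered_gaussian_vector_def gaussian_vector_def)
  show ?thesis
  proof (rule distr_eq_std_normal_vec)
    show "(\<lambda>\<omega>. transpose V *v X \<omega>) \<in> borel_measurable M" by measurable
    fix t :: "real ^ 'n"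
    have tV: "t \<bullet> (transpose V *v x) = (V *v t) \<bullet> x" for x
      by (metis dot_lmul_matrix inner_commute transpose_matrix_vector transpose_transpose)
    obtain \<sigma> where s: "0 \<le> \<sigma>" "distr M borel (\<lambda>\<omega>. (V *v t) \<bullet> X \<omega>) = gaussian_law 0 \<sigma>"
      "\<sigma>\<^sup>2 = (V *v t) \<bullet> (covariance_matrix M X *v (V *v t))"
      by (rule centered_gaussian_linear_form[OF X, of "V *v t"])
    have "\<sigma>\<^sup>2 = t \<bullet> ((transpose V ** covariance_matrix M X ** V) *v t)"
      unfolding s(3) tV[symmetric] by (simp add: matrix_vector_mul_assoc matrix_mul_assoc)
    then have n: "\<sigma>\<^sup>2 = (norm t)\<^sup>2" by (simp add: V power2_norm_eq_inner)
    have "(CLINT \<omega>|M. iexp (t \<bullet> (transpose V *v X \<omega>))) = char (distr M borel (\<lambda>\<omega>. (V *v t) \<bullet> X \<omega>)) 1"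
      by (simp add: char_def integral_distr tV del: transpose_matrix_vector)
    also have "\<dots> = exp (- (norm t)\<^sup>2 / 2)"
      unfolding s(2) char_gaussian_law[OF s(1)] by (simp add: n power_mult_distrib)
    finally show "(CLINT \<omega>|M. iexp (t \<bullet> (transpose V *v X \<omega>))) = complex_of_real (exp (- (norm t)\<^sup>2 / 2))"
      by simp
  qed
qed

text \<open>Since \<open>V\<^sup>T L = 1\<close> for square matrices, also \<open>L V\<^sup>T = 1\<close>, and \<open>L\<^sup>T = V\<^sup>T C\<close>.\<close>
lemma whitening_inverse:
  fixes C V :: "real ^ 'n ^ 'n"
  assumes V: "transpose V ** C ** V = mat 1" and C: "transpose C = C"
  defines "L \<equiv> C ** V"
  shows "L ** transpose V = mat 1" "L ** transpose L = C" "(det L)\<^sup>2 = det C"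
proof -
  have VL: "transpose V ** L = mat 1" using V by (simp add: L_def matrix_mul_assoc)
  then show LV: "L ** transpose V = mat 1" by (simp add: matrix_left_right_inverse)
  have "transpose L = transpose V ** C" by (simp add: L_def matrix_transpose_mul C)
  then have "L ** transpose L = (L ** transpose V) ** C" by (simp add: matrix_mul_assoc)
  then show *: "L ** transpose L = C" by (simp add: LV)
  show "(det L)\<^sup>2 = det C"
    by (subst *[symmetric]) (simp add: det_mul det_transpose power2_eq_square)
qed

lemma prob_via_whitening:
  fixes X :: "'a \<Rightarrow> real ^ 'n" and V :: "real ^ 'n ^ 'n"
  assumes X: "centered_gaussian_vector M X"
    and V: "transpose V ** covariance_matrix M X ** V = mat 1" 
    and C: "positive_definite (covariance_matrix M X)"
    and S: "S \<in> sets borel"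
  shows "measure M {\<omega> \<in> space M. X \<omega> \<in> S} = measure std_normal_vec {z. (covariance_matrix M X ** V) *v z \<in> S}"
proof -
  let ?L = "covariance_matrix M X ** V"
  have Xm[measurable]: "X \<in> borel_measurable M"
    using X by (auto simp: centered_gaussian_vector_def gaussian_vector_def)
  have Zm[measurable]: "(\<lambda>\<omega>. transpose V *v X \<omega>) \<in> borel_measurable M" by measurable
  have T: "{z. ?L *v z \<in> S} \<in> sets borel"
    using measurable_sets[OF measurable_matrix_vector_mult S, of ?L] by (simp add: vimage_def)
  have inv: "?L *v (transpose V *v x) = x" for x
    using whitening_inverse(1)[OF V] C by (simp add: positive_definite_def matrix_vector_mul_assoc del: transpose_matrix_vector)
  have "measure std_normal_vec {z. ?L *v z \<in> S} = measure (distr M borel (\<lambda>\<omega>. transpose V *v X \<omega>)) {z. ?L *v z \<in> S}"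
    by (simp only: gaussian_whitening[OF X V])
  also have "\<dots> = measure M {\<omega> \<in> space M. X \<omega> \<in> S}"
    by (subst measure_distr[OF Zm T]) (auto simp: inv simp del: transpose_matrix_vector intro!: arg_cong2[where f=measure])
  finally show ?thesis by simp
qed

section \<open>Sidak's inequality\<close>
lemma even_log_concave_symmetric_convex:
  fixes K :: "(real ^ 'n) set"
  assumes "K \<in> sets borel" "convex K" "\<And>x. x \<in> K \<Longrightarrow> - x \<in> K"
  shows "even_log_concave (indicator K)"
  unfolding even_log_concave_def
proof (intro conjI allI impI)
  show "indicator K (- x) = (indicator K x :: real)" for x
    using assms(3)[of x] assms(3)[of "- x"] by (auto simp: indicator_def)
  show "(indicator K x :: real) powr (1 - l) * indicator K y powr l \<le> indicator K ((1 - l) *\<^sub>R x + l *\<^sub>R y)"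
    if "0 < l" "l < 1" for x y l
    using convexD_alt[OF assms(2), of x y l] that by (auto simp: indicator_def)
qed (use assms in \<open>auto simp: indicator_def\<close>)

lemma borel_box_constraints:
  "{x :: real ^ 'n. \<forall>i\<in>I. \<bar>x $ i\<bar> \<le> \<epsilon> i} \<in> sets borel"
proof -
  have "{x :: real ^ 'n. \<forall>i\<in>I. \<bar>x $ i\<bar> \<le> \<epsilon> i} = (\<Inter>i\<in>I. {x. \<bar>x $ i\<bar> \<le> \<epsilon> i})" by auto
  also have "closed \<dots>"
    by (intro closed_INT ballI closed_Collect_le continuous_intros)
  finally show ?thesis by (rule borel_closed)
qed

text \<open>
  The column \<open>k\<close> of \<open>V\<close> is the normalised \<open>j\<close>-th axis vector, so that \<open>Z\<^sub>k\<close> is a multiple of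
  \<open>X\<^sub>j\<close>: the constraint on \<open>X\<^sub>j\<close> becomes a coordinate slab, the remaining ones a symmetric convex set.
\<close>
lemma sidak_step:
  fixes X :: "'a \<Rightarrow> real ^ 'n"
  assumes X: "centered_gaussian_vector M X" and C: "positive_definite (covariance_matrix M X)"
  shows "measure M {\<omega> \<in> space M. \<bar>X \<omega> $ j\<bar> \<le> \<epsilon> j} * measure M {\<omega> \<in> space M. \<forall>i\<in>I. \<bar>X \<omega> $ i\<bar> \<le> \<epsilon> i}
    \<le> measure M {\<omega> \<in> space M. \<forall>i\<in>insert j I. \<bar>X \<omega> $ i\<bar> \<le> \<epsilon> i}"
proof -
  let ?C = "covariance_matrix M X"
  define s where "s = axis j 1 \<bullet> (?C *v axis j 1)"
  have pos: "\<forall>x. x \<noteq> 0 \<longrightarrow> 0 < x \<bullet> (?C *v x)"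
    using C unfolding positive_definite_def by blast
  have s: "s > 0"
    unfolding s_def by (rule pos[rule_format]) (simp add: axis_eq_0_iff)
  define v where "v = (1 / sqrt s) *\<^sub>R (axis j 1 :: real ^ 'n)"
  have "v \<bullet> (?C *v v) = 1 / sqrt s * (1 / sqrt s) * s"
    unfolding v_def s_def by (simp only: matrix_vector_mult_scaleR inner_scaleR_left inner_scaleR_right mult.assoc)
  also have "\<dots> = 1" using s by (simp add: field_simps)
  finally have v1: "v \<bullet> (?C *v v) = 1" .
  obtain V :: "real ^ 'n ^ 'n" and k where V: "transpose V ** ?C ** V = mat 1" "column k V = v"
    by (rule positive_definite_diagonalise[OF C v1])
  let ?L = "?C ** V"
  have sym: "transpose ?C = ?C" using C by (simp add: positive_definite_def)
  have Lj: "(?L *v z) $ j = sqrt s * z $ k" for z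
  proof -
    have "transpose V ** ?L = mat 1"
      using V(1) by (simp only: matrix_mul_assoc)
    then have zz: "z = transpose V *v (?L *v z)"
      by (simp only: matrix_vector_mul_assoc matrix_vector_mul_lid)
    have colk: "(transpose V *v y) $ k = column k V \<bullet> y" for y
      by (simp add: matrix_vector_mult_def transpose_def column_def inner_vec_def del: transpose_matrix_vector)
    have "z $ k = (transpose V *v (?L *v z)) $ k"
      by (rule arg_cong[OF zz])
    also have "\<dots> = column k V \<bullet> (?L *v z)" by (rule colk)
    also have "\<dots> = (?L *v z) $ j / sqrt s"
      unfolding V(2) v_def by (simp add: inner_axis')
    finally have zk: "z $ k = (?L *v z) $ j / sqrt s" .
    show ?thesis unfolding zk using s by simp
  qed
  define K where "K = {x :: real ^ 'n. \<forall>i\<in>I. \<bar>x $ i\<bar> \<le> \<epsilon> i}"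
  have Kb: "K \<in> sets borel" unfolding K_def by (rule borel_box_constraints)
  define K' where "K' = {z. ?L *v z \<in> K}"
  have K'b[measurable]: "K' \<in> sets borel"
    using measurable_sets[OF measurable_matrix_vector_mult Kb, of ?L] by (simp add: vimage_def K'_def)
  have ev: "even_log_concave (indicator K')"
  proof (rule even_log_concave_symmetric_convex[OF K'b])
    have "convex K"
    proof -
      have "K = (\<Inter>i\<in>I. {x. axis i 1 \<bullet> x \<le> \<epsilon> i} \<inter> {x. axis i 1 \<bullet> x \<ge> - \<epsilon> i})"
        unfolding K_def by (force simp: inner_axis' abs_le_iff)
      also have "convex \<dots>"
        by (intro convex_INT convex_Int convex_halfspace_le convex_halfspace_ge)
      finally show ?thesis .
    qed
    then show "convex K'"
      using convex_linear_vimage[OF matrix_vector_mul_linear, of K ?L] by (simp add: K'_def vimage_def)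
    show "z \<in> K' \<Longrightarrow> - z \<in> K'" for z
      using linear_neg[OF matrix_vector_mul_linear, of ?L z] by (simp add: K'_def K_def)
  qed
  define r where "r = \<epsilon> j / sqrt s"
  have slab: "\<bar>z $ k\<bar> \<le> r \<longleftrightarrow> \<bar>(?L *v z) $ j\<bar> \<le> \<epsilon> j" for z
    using s by (simp add: Lj r_def abs_mult field_simps)
  note white = prob_via_whitening[OF X V(1) C]
  have [measurable]: "{z :: real ^ 'n. \<bar>z $ k\<bar> \<le> r} \<in> sets borel"
    by (intro borel_closed closed_Collect_le continuous_intros)
  have 1: "measure M {\<omega> \<in> space M. \<bar>X \<omega> $ j\<bar> \<le> \<epsilon> j} = measure std_normal_vec {z :: real ^ 'n. \<bar>z $ k\<bar> \<le> r}"
    using white[of "{x. \<forall>i\<in>{j}. \<bar>x $ i\<bar> \<le> \<epsilon> i}"] borel_box_constraints[of "{j}" \<epsilon>] by (simp add: slab)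
  have 2: "measure M {\<omega> \<in> space M. \<forall>i\<in>I. \<bar>X \<omega> $ i\<bar> \<le> \<epsilon> i} = (\<integral>z. indicator K' z \<partial>std_normal_vec)"
    using white[OF Kb] by (simp add: K_def K'_def)
  have "(\<integral>z. (indicator {z. \<bar>z $ k\<bar> \<le> r} z * indicator K' z :: real) \<partial>std_normal_vec)
      = (\<integral>z. indicator {z. ?L *v z \<in> {x. \<forall>i\<in>insert j I. \<bar>x $ i\<bar> \<le> \<epsilon> i}} z \<partial>std_normal_vec)"
    by (intro Bochner_Integration.integral_cong) (auto simp: indicator_def slab K'_def K_def)
  then have 3: "measure M {\<omega> \<in> space M. \<forall>i\<in>insert j I. \<bar>X \<omega> $ i\<bar> \<le> \<epsilon> i}
    = (\<integral>z. indicator {z. \<bar>z $ k\<bar> \<le> r} z * indicator K' z \<partial>std_normal_vec)"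
    using white[OF borel_box_constraints[of "insert j I" \<epsilon>]] by simp
  show ?thesis
    unfolding 1 2 3 by (rule even_log_concave_slab_correlation[OF ev])
qed

theorem sidak_inequality:
  fixes X :: "'a \<Rightarrow> real ^ 'n"
  assumes X: "centered_gaussian_vector M X" and C: "positive_definite (covariance_matrix M X)"
  shows "(\<Prod>i\<in>I. measure M {\<omega> \<in> space M. \<bar>X \<omega> $ i\<bar> \<le> \<epsilon> i}) \<le> measure M {\<omega> \<in> space M. \<forall>i\<in>I. \<bar>X \<omega> $ i\<bar> \<le> \<epsilon> i}"
  using finite[of I]
proof (induction I)
  case empty
  interpret prob_space M using X by (simp add: centered_gaussian_vector_def gaussian_vector_def)
  show ?case by (simp add: prob_space)
next
  case (insert j I)
  have "(\<Prod>i\<in>insert j I. measure M {\<omega> \<in> space M. \<bar>X \<omega> $ i\<bar> \<le> \<epsilon> i})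
    \<le> measure M {\<omega> \<in> space M. \<bar>X \<omega> $ j\<bar> \<le> \<epsilon> j} * measure M {\<omega> \<in> space M. \<forall>i\<in>I. \<bar>X \<omega> $ i\<bar> \<le> \<epsilon> i}"
    using insert by (simp add: mult_left_mono)
  also note sidak_step[OF X C]
  finally show ?case .
qed

section \<open>The upper bound\<close>

text \<open>
  This follows by estimating each mixed term with \<open>2 \<bar>w\<^sub>i w\<^sub>j\<bar> \<le> w\<^sub>i\<^sup>2 + w\<^sub>j\<^sup>2\<close>; by symmetry of \<open>C\<close> both
  halves give the same sum.
\<close>
lemma gershgorin_bound:
  fixes C :: "real ^ 'n ^ 'n" and s :: "'n \<Rightarrow> real"
  assumes sym: "transpose C = C"
    and rows: "\<And>i. (\<Sum>j\<in>UNIV. \<bar>C $ i $ j\<bar>) \<le> q * (s i)\<^sup>2"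
  shows "w \<bullet> (C *v w) \<le> q * (\<Sum>i\<in>UNIV. (s i)\<^sup>2 * (w $ i)\<^sup>2)"
proof -
  have symC: "C $ i $ j = C $ j $ i" for i j
    using sym by (metis transpose_def vec_lambda_beta)
  have "w \<bullet> (C *v w) = (\<Sum>i\<in>UNIV. \<Sum>j\<in>UNIV. C $ i $ j * (w $ i * w $ j))"
    by (simp add: inner_vec_def matrix_vector_mult_def sum_distrib_left ac_simps)
  also have "\<dots> \<le> (\<Sum>i\<in>UNIV. \<Sum>j\<in>UNIV. \<bar>C $ i $ j\<bar> * (w $ i)\<^sup>2 / 2 + \<bar>C $ i $ j\<bar> * (w $ j)\<^sup>2 / 2)"
  proof (intro sum_mono)
    fix i j
    have "2 * (\<bar>w $ i\<bar> * \<bar>w $ j\<bar>) \<le> (w $ i)\<^sup>2 + (w $ j)\<^sup>2"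
      using sum_squares_bound[of "\<bar>w $ i\<bar>" "\<bar>w $ j\<bar>"] by simp
    then have "\<bar>C $ i $ j\<bar> * (\<bar>w $ i\<bar> * \<bar>w $ j\<bar>) \<le> \<bar>C $ i $ j\<bar> * (((w $ i)\<^sup>2 + (w $ j)\<^sup>2) / 2)"
      by (intro mult_left_mono) auto
    moreover have "C $ i $ j * (w $ i * w $ j) \<le> \<bar>C $ i $ j\<bar> * (\<bar>w $ i\<bar> * \<bar>w $ j\<bar>)"
      by (metis abs_ge_self abs_mult)
    ultimately show "C $ i $ j * (w $ i * w $ j) \<le> \<bar>C $ i $ j\<bar> * (w $ i)\<^sup>2 / 2 + \<bar>C $ i $ j\<bar> * (w $ j)\<^sup>2 / 2"
      by (simp add: algebra_simps add_divide_distrib)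
  qed
  also have "\<dots> = (\<Sum>i\<in>UNIV. \<Sum>j\<in>UNIV. \<bar>C $ i $ j\<bar> * (w $ i)\<^sup>2 / 2) + (\<Sum>i\<in>UNIV. \<Sum>j\<in>UNIV. \<bar>C $ i $ j\<bar> * (w $ j)\<^sup>2 / 2)"
    by (simp add: sum.distrib)
  also have "(\<Sum>i\<in>UNIV. \<Sum>j\<in>UNIV. \<bar>C $ i $ j\<bar> * (w $ j)\<^sup>2 / 2) = (\<Sum>i\<in>UNIV. \<Sum>j\<in>UNIV. \<bar>C $ i $ j\<bar> * (w $ i)\<^sup>2 / 2)"
    by (subst sum.swap) (simp add: symC)
  also have "(\<Sum>i\<in>UNIV. \<Sum>j\<in>UNIV. \<bar>C $ i $ j\<bar> * (w $ i)\<^sup>2 / 2) + (\<Sum>i\<in>UNIV. \<Sum>j\<in>UNIV. \<bar>C $ i $ j\<bar> * (w $ i)\<^sup>2 / 2)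
    = (\<Sum>i\<in>UNIV. (\<Sum>j\<in>UNIV. \<bar>C $ i $ j\<bar>) * (w $ i)\<^sup>2)"
    by (simp add: sum.distrib[symmetric] sum_distrib_right)
  also have "\<dots> \<le> (\<Sum>i\<in>UNIV. q * (s i)\<^sup>2 * (w $ i)\<^sup>2)"
    by (intro sum_mono mult_right_mono rows) auto
  finally show ?thesis by (simp add: sum_distrib_left mult.assoc)
qed

text \<open>
  This transfers Gershgorin's bound from \<open>C = L L\<^sup>T\<close> to \<open>L\<^sup>T D\<^sup>-\<^sup>1 L\<close>, where \<open>D = diag(s\<^sub>i\<^sup>2)\<close>: with
  \<open>w = D\<^sup>-\<^sup>1 L z\<close> the left-hand side \<open>Q\<close> equals \<open>z \<bullet> L\<^sup>T w\<close>, and Cauchy-Schwarz together with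
  \<open>\<bar>L\<^sup>T w\<bar>\<^sup>2 = w \<bullet> C w \<le> q Q\<close> gives \<open>Q\<^sup>2 \<le> q Q \<bar>z\<bar>\<^sup>2\<close>.
\<close>
lemma whitened_energy_bound:
  fixes L C :: "real ^ 'n ^ 'n" and s :: "'n \<Rightarrow> real"
  assumes LL: "L ** transpose L = C" and s: "\<And>i. s i > 0"
    and rows: "\<And>i. (\<Sum>j\<in>UNIV. \<bar>C $ i $ j\<bar>) \<le> q * (s i)\<^sup>2"
  shows "(\<Sum>i\<in>UNIV. ((L *v z) $ i)\<^sup>2 / (s i)\<^sup>2) \<le> q * (norm z)\<^sup>2"
proof -
  define Q where "Q = (\<Sum>i\<in>UNIV. ((L *v z) $ i)\<^sup>2 / (s i)\<^sup>2)"
  define w where "w = (\<chi> i. (L *v z) $ i / (s i)\<^sup>2)"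
  define y where "y = transpose L *v w"
  have sym: "transpose C = C" by (simp add: LL[symmetric] matrix_transpose_mul)
  have shift: "x \<bullet> (transpose L *v v) = (L *v x) \<bullet> v" for x v
    by (metis dot_lmul_matrix inner_commute transpose_matrix_vector transpose_transpose)
  have Q0: "0 \<le> Q" by (auto simp: Q_def intro!: sum_nonneg)
  have "z \<bullet> y = (L *v z) \<bullet> w" unfolding y_def by (rule shift)
  also have "\<dots> = Q" by (simp add: Q_def w_def inner_vec_def power2_eq_square)
  finally have zy: "z \<bullet> y = Q" .
  have "(norm y)\<^sup>2 = (L *v y) \<bullet> w" unfolding power2_norm_eq_inner by (subst (2) y_def) (rule shift)
  also have "\<dots> = w \<bullet> (C *v w)" by (simp add: y_def matrix_vector_mul_assoc LL inner_commute del: transpose_matrix_vector)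
  also have "\<dots> \<le> q * (\<Sum>i\<in>UNIV. (s i)\<^sup>2 * (w $ i)\<^sup>2)"
    by (rule gershgorin_bound[OF sym rows])
  also have "(\<Sum>i\<in>UNIV. (s i)\<^sup>2 * (w $ i)\<^sup>2) = Q"
    unfolding Q_def using s by (intro sum.cong) (auto simp: w_def power2_eq_square less_imp_neq[symmetric])
  finally have y2: "(norm y)\<^sup>2 \<le> q * Q" .
  have "Q\<^sup>2 \<le> (norm z * norm y)\<^sup>2"
    using norm_cauchy_schwarz[of z y] Q0 unfolding zy by (rule power_mono)
  also have "\<dots> \<le> (norm z)\<^sup>2 * (q * Q)"
    unfolding power_mult_distrib by (intro mult_left_mono y2) auto
  finally have "Q * Q \<le> (q * (norm z)\<^sup>2) * Q" by (simp add: power2_eq_square ac_simps)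
  then have *: "Q = 0 \<or> Q \<le> q * (norm z)\<^sup>2" using Q0 by (auto simp: mult_le_cancel_right)
  have "0 \<le> q"
  proof -
    obtain i :: 'n where True by simp
    have "0 \<le> (\<Sum>j\<in>UNIV. \<bar>C $ i $ j\<bar>)" by (intro sum_nonneg) auto
    then have "0 \<le> q * (s i)\<^sup>2" using rows[of i] by linarith
    then show ?thesis using s[of i] by (simp add: zero_le_mult_iff)
  qed
  then show ?thesis using * by (auto simp: Q_def[symmetric])
qed

lemma ln_normal_density:
  "\<sigma> > 0 \<Longrightarrow> ln (normal_density 0 \<sigma> x) = - ln (2 * pi) / 2 - ln \<sigma> - x\<^sup>2 / (2 * \<sigma>\<^sup>2)"
  by (simp add: normal_density_def ln_mult ln_div ln_sqrt real_sqrt_mult)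

lemma norm_sq_vec: "(norm (z :: real ^ 'n))\<^sup>2 = (\<Sum>i\<in>UNIV. (z $ i)\<^sup>2)"
  unfolding power2_norm_eq_inner by (simp add: inner_vec_def power2_eq_square)

lemma normal_density_nonzero: "\<sigma> > 0 \<Longrightarrow> normal_density \<mu> \<sigma> x \<noteq> 0"
  using normal_density_pos[of \<sigma> \<mu> x] by simp

text \<open>
  In logarithms the constant terms on both sides agree, and what is left to compare are the
  quadratic forms: \<open>Q / (2 * p) + (1 - 1 / p) * \<bar>z\<bar>\<^sup>2 / 4 \<le> \<bar>z\<bar>\<^sup>2 / 2\<close>, which says
  \<open>Q \<le> (p + 1) / 2 * \<bar>z\<bar>\<^sup>2\<close>. The variance \<open>2\<close> of the last factor is chosen to make this hold.
\<close>
lemma gaussian_density_interpolation: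
  fixes L C :: "real ^ 'n ^ 'n" and s :: "'n \<Rightarrow> real"
  assumes LL: "L ** transpose L = C" and d: "(det L)\<^sup>2 = det C" "det C > 0" and s: "\<And>i. s i > 0"
    and rows: "\<And>i. (\<Sum>j\<in>UNIV. \<bar>C $ i $ j\<bar>) \<le> q * (s i)\<^sup>2" and p: "p \<ge> 2" "2 * q \<le> p"
  shows "(\<Prod>i\<in>UNIV. std_normal_density (z $ i))
    \<le> exp ((1 - 1 / p) * (real CARD('n) / 2 * ln 2) + (1 / p) * ((\<Sum>i\<in>UNIV. ln (s i)) - ln (det C) / 2))
      * ((\<bar>det L\<bar> * (\<Prod>i\<in>UNIV. normal_density 0 (s i) ((L *v z) $ i))) powr (1 / p)
        * (\<Prod>i\<in>UNIV. normal_density 0 (sqrt 2) (z $ i)) powr (1 - 1 / p))"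
    (is "?lhs \<le> exp ?k * (?u powr _ * ?v powr _)")
proof -
  define n where "n = real CARD('n)"
  define c where "c = ln (2 * pi) / 2"
  define Q where "Q = (\<Sum>i\<in>UNIV. ((L *v z) $ i)\<^sup>2 / (s i)\<^sup>2)"
  define R where "R = (norm z)\<^sup>2"
  define S where "S = (\<Sum>i\<in>UNIV. ln (s i))"
  have dL: "det L \<noteq> 0" using d by auto
  have ldL: "ln \<bar>det L\<bar> = ln (det C) / 2"
    unfolding d(1)[symmetric] using dL by (simp add: ln_realpow[of "\<bar>det L\<bar>" 2, simplified])
  have pos: "?lhs > 0" "?u > 0" "?v > 0"
    using s dL by (auto intro!: prod_pos mult_pos_pos simp: normal_density_pos)
  have l1: "ln ?lhs = - (n * c) - R / 2"
    by (subst ln_prod) (auto simp: normal_density_pos normal_density_nonzero ln_normal_density[of 1, simplified] sum_subtractf sum_negf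
        n_def c_def R_def norm_sq_vec sum_divide_distrib)
  have l2: "ln ?v = - (n * c) - n * ln 2 / 2 - R / 4"
    by (subst ln_prod) (auto simp: normal_density_pos normal_density_nonzero ln_normal_density sum_subtractf sum_negf ln_sqrt right_diff_distrib
        n_def c_def R_def norm_sq_vec sum_divide_distrib)
  have l3: "ln ?u = ln (det C) / 2 - n * c - S - Q / 2"
  proof -
    have pr: "ln (\<Prod>i\<in>UNIV. normal_density 0 (s i) ((L *v z) $ i)) = - (n * c) - S - Q / 2"
      using s by (subst ln_prod, auto simp: normal_density_pos normal_density_nonzero ln_normal_density sum_subtractf sum_negf
        n_def c_def S_def Q_def sum_divide_distrib) (simp add: mult.commute)
    have pu: "(\<Prod>i\<in>UNIV. normal_density 0 (s i) ((L *v z) $ i)) > 0"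
      using s by (intro prod_pos) (auto simp: normal_density_pos)
    have "ln ?u = ln \<bar>det L\<bar> + ln (\<Prod>i\<in>UNIV. normal_density 0 (s i) ((L *v z) $ i))"
      using dL pu by (intro ln_mult_pos) auto
    then have "ln ?u = ln (det C) / 2 + (- (n * c) - S - Q / 2)"
      by (simp only: ldL pr)
    then show ?thesis by (simp only: algebra_simps)
  qed
  have "Q \<le> q * R" unfolding Q_def R_def by (rule whitened_energy_bound[OF LL s rows])
  also have "\<dots> \<le> ((p + 1) / 2) * R"
    using p by (intro mult_right_mono) (auto simp: R_def)
  finally have "Q / (2 * p) \<le> ((p + 1) / 2) * R / (2 * p)"
    using p by (intro divide_right_mono) auto
  also have "\<dots> = R / 2 - (1 - 1 / p) * R / 4" using p by (simp add: field_simps)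
  finally have key: "Q / (2 * p) \<le> R / 2 - (1 - 1 / p) * R / 4" .
  have "ln ?lhs \<le> ?k + ((1 / p) * ln ?u + (1 - 1 / p) * ln ?v)"
  proof -
    have "?k + ((1 / p) * ln ?u + (1 - 1 / p) * ln ?v) = - (n * c) - Q / (2 * p) - (1 - 1 / p) * R / 4"
      unfolding l2 l3 n_def[symmetric] S_def[symmetric] using p by (simp add: field_simps)
    then show ?thesis using key l1 by linarith
  qed
  then have "exp (ln ?lhs) \<le> exp (?k + ((1 / p) * ln ?u + (1 - 1 / p) * ln ?v))"
    by (simp only: exp_le_cancel_iff)
  moreover have pw: "exp (a * ln x) = x powr a" if "x > 0" for x a :: real
    using that by (simp add: powr_def)
  ultimately show ?thesis
    by (simp only: exp_add[of ?k] exp_add[of "(1 / p) * ln ?u"] exp_ln[OF pos(1)] pw[OF pos(2)] pw[OF pos(3)])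
qed

lemma (in prob_space) coordinate_prob_density:
  assumes Y: "Y \<in> borel_measurable M" and law: "distr M borel Y = gaussian_law 0 \<sigma>" and \<sigma>: "\<sigma> > 0"
  shows "(\<integral>\<^sup>+x. ennreal (normal_density 0 \<sigma> x) * indicator {- e..e} x \<partial>lborel)
    = ennreal (prob {\<omega> \<in> space M. \<bar>Y \<omega>\<bar> \<le> e})"
proof -
  have "(\<integral>\<^sup>+x. ennreal (normal_density 0 \<sigma> x) * indicator {- e..e} x \<partial>lborel) = emeasure (gaussian_law 0 \<sigma>) {- e..e}"
    using \<sigma> by (simp add: gaussian_law_def emeasure_density)
  also have "\<dots> = emeasure M {\<omega> \<in> space M. \<bar>Y \<omega>\<bar> \<le> e}"
    unfolding law[symmetric]
    by (subst emeasure_distr[OF Y]) (auto simp: abs_le_iff intro!: arg_cong2[where f=emeasure])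
  finally show ?thesis by (simp add: emeasure_eq_measure)
qed

lemma ennreal_affine:
  "0 \<le> K \<Longrightarrow> 0 \<le> a \<Longrightarrow> 0 \<le> b \<Longrightarrow> 0 \<le> x \<Longrightarrow> 0 \<le> y \<Longrightarrow>
    ennreal (K * (a * x + b * y)) = ennreal K * (ennreal a * ennreal x + ennreal b * ennreal y)"
  by (simp add: ennreal_mult)

text \<open>
  Hoelder's inequality for the product in the pointwise bound is applied through Young's
  inequality, after dividing \<open>u\<close> by its integral \<open>A\<close> over the box. This needs \<open>A > 0\<close>; if some
  one-dimensional probability vanishes, the left-hand side vanishes too.
\<close>
theorem gaussian_box_upper_bound:
  fixes X :: "'a \<Rightarrow> real ^ 'n" and \<sigma> \<epsilon> :: "'n \<Rightarrow> real"
  assumes X: "centered_gaussian_vector M X"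
    and s: "\<And>i. \<sigma> i > 0"
    and var: "\<And>i. (LINT \<omega>|M. (X \<omega> $ i)\<^sup>2) = (\<sigma> i)\<^sup>2"
    and C: "positive_definite (covariance_matrix M X)"
    and p: "p \<ge> 2" "p \<ge> 2 * decoupling_coefficient M X"
  shows "measure M {\<omega> \<in> space M. \<forall>i\<in>UNIV. \<bar>X \<omega> $ i\<bar> \<le> \<epsilon> i}
    \<le> 2 powr (real CARD('n) / 2) / det (covariance_matrix M X) powr (1 / (2 * p))
             * (\<Prod>i\<in>UNIV. (\<sigma> i / sqrt 2 * measure M {\<omega> \<in> space M. \<bar>X \<omega> $ i\<bar> \<le> \<epsilon> i}) powr (1 / p))"
proof -
  interpret prob_space M using X by (simp add: centered_gaussian_vector_def gaussian_vector_def)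
  have Xm[measurable]: "X \<in> borel_measurable M"
    using X by (auto simp: centered_gaussian_vector_def gaussian_vector_def)
  have nth[measurable]: "(\<lambda>\<omega>. X \<omega> $ i) \<in> borel_measurable M" for i
    using measurable_compose[OF Xm borel_measurable_nth] by simp
  let ?C = "covariance_matrix M X"
  define P where "P i = prob {\<omega> \<in> space M. \<bar>X \<omega> $ i\<bar> \<le> \<epsilon> i}" for i
  define A where "A = (\<Prod>i\<in>UNIV. P i)"
  define B where "B = {x :: real ^ 'n. \<forall>i\<in>UNIV. \<bar>x $ i\<bar> \<le> \<epsilon> i}"
  have Bb[measurable]: "B \<in> sets borel" unfolding B_def by (rule borel_box_constraints)
  show ?thesis
  proof (cases "\<exists>i. P i = 0")
    case True
    then obtain i where i: "P i = 0" by auto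
    have "prob {\<omega> \<in> space M. \<forall>i\<in>UNIV. \<bar>X \<omega> $ i\<bar> \<le> \<epsilon> i} \<le> P i"
      unfolding P_def by (rule finite_measure_mono) (auto, measurable)
    also have "\<dots> = 0" by (rule i)
    also have "\<dots> \<le> 2 powr (real CARD('n) / 2) / det ?C powr (1 / (2 * p))
             * (\<Prod>i\<in>UNIV. (\<sigma> i / sqrt 2 * P i) powr (1 / p))"
      by (intro mult_nonneg_nonneg prod_nonneg) auto
    finally show ?thesis by (simp add: P_def)
  next
    case False
    then have P0: "P i > 0" for i by (auto simp: P_def less_le)
    have A0: "A > 0" unfolding A_def by (intro prod_pos) (auto simp: P0)
    have sym: "transpose ?C = ?C" and pos: "\<forall>x. x \<noteq> 0 \<longrightarrow> 0 < x \<bullet> (?C *v x)"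
      using C unfolding positive_definite_def by blast+
    have Cii: "?C $ i $ i = (\<sigma> i)\<^sup>2" for i
      using var[of i] by (simp add: covariance_matrix_def power2_eq_square)
    \<comment> \<open>any unit vector for the form can start the diagonalisation\<close>
    obtain i0 :: 'n where True by simp
    define v where "v = (1 / \<sigma> i0) *\<^sub>R (axis i0 1 :: real ^ 'n)"
    have axis_form: "axis i 1 \<bullet> (?C *v axis i 1) = (\<sigma> i)\<^sup>2" for i
      by (simp add: inner_axis' matrix_vector_mult_basis column_def Cii)
    have "v \<bullet> (?C *v v) = 1 / \<sigma> i0 * (1 / \<sigma> i0) * (\<sigma> i0)\<^sup>2"
      unfolding v_def axis_form[symmetric] by (simp only: matrix_vector_mult_scaleR inner_scaleR_left inner_scaleR_right mult.assoc)
    also have "\<dots> = 1" using s[of i0] by (simp add: power2_eq_square)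
    finally have v1: "v \<bullet> (?C *v v) = 1" .
    obtain V :: "real ^ 'n ^ 'n" and k where V: "transpose V ** ?C ** V = mat 1" "column k V = v"
      by (rule positive_definite_diagonalise[OF C v1])
    define L where "L = ?C ** V"
    note L = whitening_inverse[OF V(1) sym, folded L_def]
    have dL: "det L \<noteq> 0"
      using arg_cong[OF L(1), of det] by (auto simp: det_mul)
    then have dC: "det ?C > 0" unfolding L(3)[symmetric] by simp
    define q where "q = decoupling_coefficient M X"
    have rows: "(\<Sum>j\<in>UNIV. \<bar>?C $ i $ j\<bar>) \<le> q * (\<sigma> i)\<^sup>2" for i
    proof -
      have "(\<Sum>j\<in>UNIV. \<bar>LINT \<omega>|M. X \<omega> $ i * X \<omega> $ j\<bar> / (LINT \<omega>|M. (X \<omega> $ i)\<^sup>2)) \<le> q"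
        unfolding q_def decoupling_coefficient_def by (rule Max_ge) auto
      then have "(\<Sum>j\<in>UNIV. \<bar>?C $ i $ j\<bar>) / (\<sigma> i)\<^sup>2 \<le> q"
        by (simp add: var covariance_matrix_def sum_divide_distrib)
      then show ?thesis using s[of i] by (simp add: divide_le_eq)
    qed
    define \<kappa> where "\<kappa> = (1 - 1 / p) * (real CARD('n) / 2 * ln 2) + (1 / p) * ((\<Sum>i\<in>UNIV. ln (\<sigma> i)) - ln (det ?C) / 2)"
    define u where "u z = \<bar>det L\<bar> * (\<Prod>i\<in>UNIV. normal_density 0 (\<sigma> i) ((L *v z) $ i))" for z
    define w where "w z = (\<Prod>i\<in>UNIV. normal_density 0 (sqrt 2) (z $ i))" for z :: "real ^ 'n"
    have u0: "u z > 0" and w0: "w z > 0" for z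
      using s dL by (auto simp: u_def w_def intro!: mult_pos_pos prod_pos normal_density_pos)
    have young: "(\<Prod>i\<in>UNIV. std_normal_density (z $ i)) \<le> exp \<kappa> * A powr (1 / p) * ((1 / p) * (u z / A) + (1 - 1 / p) * w z)" for z
    proof -
      have "(\<Prod>i\<in>UNIV. std_normal_density (z $ i)) \<le> exp \<kappa> * (u z powr (1 / p) * w z powr (1 - 1 / p))"
        unfolding \<kappa>_def u_def w_def
        by (rule gaussian_density_interpolation[OF L(2,3) dC s rows]) (use p in \<open>auto simp: q_def\<close>)
      also have "u z powr (1 / p) = A powr (1 / p) * (u z / A) powr (1 / p)"
        using u0[of z] A0 by (simp add: powr_divide)
      also have "exp \<kappa> * (A powr (1 / p) * (u z / A) powr (1 / p) * w z powr (1 - 1 / p))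
        = exp \<kappa> * A powr (1 / p) * ((u z / A) powr (1 / p) * w z powr (1 - 1 / p))" by simp
      also have "\<dots> \<le> exp \<kappa> * A powr (1 / p) * ((1 / p) * (u z / A) + (1 - 1 / p) * w z)"
        using p u0[of z] w0[of z] A0 by (intro mult_left_mono Youngs_inequality_0) auto
      finally show ?thesis .
    qed
    have [measurable]: "{z. L *v z \<in> B} \<in> sets borel"
      using measurable_sets[OF measurable_matrix_vector_mult Bb, of L] by (simp add: vimage_def)
    have Lm[measurable]: "(\<lambda>z. (L *v z) $ i) \<in> borel_measurable borel" for i
      by (rule measurable_compose[OF measurable_matrix_vector_mult borel_measurable_nth])
    have zm[measurable]: "(\<lambda>z :: real ^ 'n. z $ i) \<in> borel_measurable borel" for i
      by (rule borel_measurable_nth)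
    have um[measurable]: "u \<in> borel_measurable borel" and wm[measurable]: "w \<in> borel_measurable borel"
      unfolding u_def[abs_def] w_def[abs_def] by measurable
    have Pint: "(\<integral>\<^sup>+x. ennreal (normal_density 0 (\<sigma> i) x) * indicator {- \<epsilon> i..\<epsilon> i} x \<partial>lborel) = ennreal (P i)" for i
    proof -
      have ax: "axis i 1 \<bullet> X \<omega> = X \<omega> $ i" for \<omega> by (simp add: inner_axis')
      obtain t where t: "0 \<le> t" "distr M borel (\<lambda>\<omega>. axis i 1 \<bullet> X \<omega>) = gaussian_law 0 t"
        "t\<^sup>2 = axis i 1 \<bullet> (?C *v axis i 1)"
        by (rule centered_gaussian_linear_form[OF X, of "axis i 1"])
      have "t = \<sigma> i" using t(1,3) s[of i] unfolding axis_form by (simp add: power2_eq_iff_nonneg)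
      then show ?thesis
        unfolding P_def by (intro coordinate_prob_density[OF nth _ s]) (use t(2) in \<open>simp add: ax\<close>)
    qed
    have uint: "(\<integral>\<^sup>+z. ennreal (u z) * indicator {z. L *v z \<in> B} z \<partial>lborel) = ennreal A"
    proof -
      define g :: "real ^ 'n \<Rightarrow> ennreal" where "g x = (\<Prod>i\<in>UNIV. ennreal (normal_density 0 (\<sigma> i) (x $ i)) * indicator {- \<epsilon> i..\<epsilon> i} (x $ i))" for x
      have gm: "g \<in> borel_measurable borel" unfolding g_def[abs_def] by measurable
      have gL: "(\<lambda>z. g (L *v z)) \<in> borel_measurable borel"
        by (rule measurable_compose[OF measurable_matrix_vector_mult gm])
      have "ennreal (u z) * indicator {z. L *v z \<in> B} z = ennreal \<bar>det L\<bar> * g (L *v z)" for z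
      proof -
        have "(\<Prod>i\<in>UNIV. indicator {- \<epsilon> i..\<epsilon> i} ((L *v z) $ i)) = (indicator {z. L *v z \<in> B} z :: ennreal)"
        proof (cases "L *v z \<in> B")
          case True
          then have "- \<epsilon> i \<le> (L *v z) $ i \<and> (L *v z) $ i \<le> \<epsilon> i" for i
            by (simp add: B_def) (smt (verit))
          then show ?thesis using True by simp
        next
          case False
          then obtain i where "\<not> \<bar>(L *v z) $ i\<bar> \<le> \<epsilon> i" by (auto simp: B_def)
          then have "(L *v z) $ i \<notin> {- \<epsilon> i..\<epsilon> i}" by auto
          then have "(indicator {- \<epsilon> i..\<epsilon> i} ((L *v z) $ i) :: ennreal) = 0" by simp
          then show ?thesis using False by (subst prod_zero) auto
        qed
        then show ?thesis
          unfolding u_def g_def prod.distrib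
          by (subst ennreal_mult) (simp_all add: prod_nonneg prod_ennreal mult.assoc)
      qed
      then have "(\<integral>\<^sup>+z. ennreal (u z) * indicator {z. L *v z \<in> B} z \<partial>lborel) = ennreal \<bar>det L\<bar> * (\<integral>\<^sup>+z. g (L *v z) \<partial>lborel)"
        using gL by (simp add: nn_integral_cmult)
      also have "\<dots> = (\<integral>\<^sup>+x. g x \<partial>lborel)"
        by (rule nn_integral_lborel_linear[OF dL gm, symmetric])
      also have "\<dots> = (\<Prod>i\<in>UNIV. \<integral>\<^sup>+x. ennreal (normal_density 0 (\<sigma> i) x) * indicator {- \<epsilon> i..\<epsilon> i} x \<partial>lborel)"
        unfolding g_def by (rule nn_integral_lborel_vec_prod) measurable
      also have "\<dots> = ennreal A"
        unfolding Pint A_def by (rule prod_ennreal) (simp add: P0 less_imp_le)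
      finally show ?thesis .
    qed
    have wint: "(\<integral>\<^sup>+z. ennreal (w z) \<partial>lborel) = 1"
    proof -
      have "(\<integral>\<^sup>+z. ennreal (w z) \<partial>lborel) = (\<integral>\<^sup>+z. (\<Prod>i\<in>UNIV. ennreal (normal_density 0 (sqrt 2) (z $ i))) \<partial>(lborel :: (real ^ 'n) measure))"
        unfolding w_def by (simp add: prod_ennreal)
      also have "\<dots> = (\<Prod>i\<in>(UNIV :: 'n set). \<integral>\<^sup>+x. ennreal (normal_density 0 (sqrt 2) x) \<partial>lborel)"
        by (rule nn_integral_lborel_vec_prod) measurable
      also have "(\<integral>\<^sup>+x. ennreal (normal_density 0 (sqrt 2) x) \<partial>lborel) = 1"
        by (subst nn_integral_eq_integral) auto
      finally show ?thesis by simp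
    qed
    define K where "K = exp \<kappa> * A powr (1 / p)"
    have K0: "K \<ge> 0" by (simp add: K_def)
    have "prob {\<omega> \<in> space M. \<forall>i\<in>UNIV. \<bar>X \<omega> $ i\<bar> \<le> \<epsilon> i} = measure std_normal_vec {z. L *v z \<in> B}"
      using prob_via_whitening[OF X V(1) C Bb] by (simp add: L_def B_def)
    then have "ennreal (prob {\<omega> \<in> space M. \<forall>i\<in>UNIV. \<bar>X \<omega> $ i\<bar> \<le> \<epsilon> i}) = emeasure std_normal_vec {z. L *v z \<in> B}"
      by (simp add: std_normal_vec.emeasure_eq_measure)
    also have "\<dots> = (\<integral>\<^sup>+z. ennreal (\<Prod>i\<in>UNIV. std_normal_density (z $ i)) * indicator {z. L *v z \<in> B} z \<partial>lborel)"
      unfolding std_normal_vec_density by (subst emeasure_density) (auto simp: prod_ennreal)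
    also have "\<dots> \<le> (\<integral>\<^sup>+z. ennreal K * (ennreal (1 / (p * A)) * (ennreal (u z) * indicator {z. L *v z \<in> B} z) + ennreal (1 - 1 / p) * ennreal (w z)) \<partial>lborel)"
    proof (rule nn_integral_mono)
      fix z :: "real ^ 'n"
      have "ennreal (\<Prod>i\<in>UNIV. std_normal_density (z $ i)) \<le> ennreal (K * (1 / (p * A) * u z + (1 - 1 / p) * w z))"
        using young[of z] by (intro ennreal_leI) (simp add: K_def)
      also have "\<dots> = ennreal K * (ennreal (1 / (p * A)) * ennreal (u z) + ennreal (1 - 1 / p) * ennreal (w z))"
        using K0 p A0 u0[of z] w0[of z] by (intro ennreal_affine) auto
      finally show "ennreal (\<Prod>i\<in>UNIV. std_normal_density (z $ i)) * indicator {z. L *v z \<in> B} z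
        \<le> ennreal K * (ennreal (1 / (p * A)) * (ennreal (u z) * indicator {z. L *v z \<in> B} z) + ennreal (1 - 1 / p) * ennreal (w z))"
        by (auto simp: indicator_def)
    qed
    also have "\<dots> = ennreal K * (ennreal (1 / (p * A)) * ennreal A + ennreal (1 - 1 / p) * 1)"
      by (simp add: nn_integral_cmult nn_integral_add uint wint)
    also have "\<dots> = ennreal (K * (1 / (p * A) * A + (1 - 1 / p) * 1))"
      using K0 p A0 by (subst ennreal_affine) auto
    also have "K * (1 / (p * A) * A + (1 - 1 / p) * 1) = K" using p A0 by simp
    finally have main: "prob {\<omega> \<in> space M. \<forall>i\<in>UNIV. \<bar>X \<omega> $ i\<bar> \<le> \<epsilon> i} \<le> K"
      using K0 by (subst (asm) ennreal_le_iff) auto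
    \<comment> \<open>the two constants agree, as comparing logarithms shows\<close>
    have "K = 2 powr (real CARD('n) / 2) / det ?C powr (1 / (2 * p)) * (\<Prod>i\<in>UNIV. (\<sigma> i / sqrt 2 * P i) powr (1 / p))"
    proof -
      have "(\<sigma> i / sqrt 2 * P i) powr (1 / p) = exp ((1 / p) * (ln (\<sigma> i) - ln 2 / 2 + ln (P i)))" for i
        using s[of i] P0[of i] by (simp add: powr_def ln_mult ln_div ln_sqrt)
      then have "(\<Prod>i\<in>UNIV. (\<sigma> i / sqrt 2 * P i) powr (1 / p)) = exp (\<Sum>i\<in>UNIV. (1 / p) * (ln (\<sigma> i) - ln 2 / 2 + ln (P i)))"
        by (simp add: exp_sum)
      also have "(\<Sum>i\<in>UNIV. (1 / p) * (ln (\<sigma> i) - ln 2 / 2 + ln (P i))) = (1 / p) * ((\<Sum>i\<in>UNIV. ln (\<sigma> i)) - real CARD('n) * (ln 2 / 2) + (\<Sum>i\<in>UNIV. ln (P i)))"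
        unfolding sum_distrib_left[symmetric] by (simp add: sum.distrib sum_subtractf)
      also have "(\<Sum>i\<in>UNIV. ln (P i)) = ln A"
        unfolding A_def by (subst ln_prod) (auto simp: P0 less_imp_neq[OF P0, symmetric])
      finally have E: "(\<Prod>i\<in>UNIV. (\<sigma> i / sqrt 2 * P i) powr (1 / p)) = exp ((1 / p) * ((\<Sum>i\<in>UNIV. ln (\<sigma> i)) - real CARD('n) * (ln 2 / 2) + ln A))" .
      have "2 powr (real CARD('n) / 2) = exp (real CARD('n) / 2 * ln 2)" by (simp add: powr_def)
      moreover have "det ?C powr (1 / (2 * p)) = exp (1 / (2 * p) * ln (det ?C))" using dC by (simp add: powr_def)
      moreover have "A powr (1 / p) = exp ((1 / p) * ln A)" using A0 by (simp add: powr_def)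
      ultimately show ?thesis
        unfolding K_def E \<kappa>_def using p
        by (simp only: exp_diff[symmetric] exp_add[symmetric]) (simp add: field_simps)
    qed
    then show ?thesis using main by (simp add: P_def)
  qed
qed

lemma SUP_ratio_le_1_iff:
  fixes \<epsilon> :: "'n :: finite \<Rightarrow> real"
  assumes "\<And>i. \<epsilon> i > 0"
  shows "(SUP i. \<bar>x i\<bar> / \<epsilon> i) \<le> 1 \<longleftrightarrow> (\<forall>i\<in>UNIV. \<bar>x i\<bar> \<le> \<epsilon> i)"
  using assms by (subst cSup_le_iff) (auto simp: divide_le_eq)

theorem corollary1p3:
  fixes M :: "'a measure"
    and X :: "'a \<Rightarrow> real ^ 'n"
    and \<sigma> \<epsilon> :: "'n \<Rightarrow> real"
    and p :: real
  assumes "centered_gaussian_vector M X"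
    and "\<And>i. \<sigma> i > 0"
    and "\<And>i. (LINT \<omega>|M. (X \<omega> $ i)\<^sup>2) = (\<sigma> i)\<^sup>2"
    and "positive_definite (covariance_matrix M X)"
    and "p \<ge> 2"
    and "p \<ge> 2 * decoupling_coefficient M X"
    and "\<And>i. \<epsilon> i > 0"
  shows "(\<Prod>i\<in>UNIV. \<P>(\<omega> in M. \<bar>X \<omega> $ i\<bar> \<le> \<epsilon> i))
           \<le> \<P>(\<omega> in M. (SUP i. \<bar>X \<omega> $ i\<bar> / \<epsilon> i) \<le> 1)
       \<and> \<P>(\<omega> in M. (SUP i. \<bar>X \<omega> $ i\<bar> / \<epsilon> i) \<le> 1)
           \<le> 2 powr (real CARD('n) / 2) / det (covariance_matrix M X) powr (1 / (2 * p))
             * (\<Prod>i\<in>UNIV. (\<sigma> i / sqrt 2 * \<P>(\<omega> in M. \<bar>X \<omega> $ i\<bar> \<le> \<epsilon> i)) powr (1 / p))"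
  unfolding SUP_ratio_le_1_iff[OF assms(7)]
  using sidak_inequality[OF assms(1,4), where I = UNIV and \<epsilon> = \<epsilon>] gaussian_box_upper_bound[OF assms(1-6), where \<epsilon> = \<epsilon>]
  by blast

end
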